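(* Let $P_0,P_1$ be probability measures on a measurable space $\mathcal Y$ with $P_1\ll P_0$, let $r=\mathrm dP_1/\mathrm dP_0$, $g=r-1$, $\rho^2=\mathbb E_{P_0}[g^2]$, and suppose $0<\rho^2<\infty$ and $\mathbb E_{P_0}|g|^{2+\epsilon}<\infty$ for some $\epsilon>0$. Let $Q_\alpha=(1-\alpha)P_0+\alpha P_1$ and $$Z_m=\frac1{\rho\sqrt m}\sum_{i=1}^m g(Y_i).$$ Fix $h\ge0$ and $\tau\in(0,1)$, and let $\alpha_m=h/(\rho\sqrt m)$ for all sufficiently large $m$ (so that $\alpha_m\in[0,1]$). Then, as $m\to\infty$: (i) $\displaystyle \log\frac{\mathrm dQ_{\alpha_m}^{\otimes m}}{\mathrm dP_0^{\otimes m}}(Y_1,\dots,Y_m)=hZ_m-\frac{h^2}{2}+o_{P_0}(1)$. (ii) $Z_m$ converges in distribution to $\mathcal N(0,1)$ under $P_0^{\otimes m}$, and to $\mathcal N(h,1)$ under $Q_{\alpha_m}^{\otimes m}$. (iii) The test $\mathbf 1\{Z_m>z_{1-\tau}\}$ has asymptotic size $\tau$ and asymptotic power $1-\Phi(z_{1-\tau}-h)$, i.e. $P_0^{\otimes m}(Z_m>z_{1-\tau})\to\tau$ and $Q_{\alpha_m}^{\otimes m}(Z_m>z_{1-\tau})\to1-\Phi(z_{1-\tau}-h)$. (iv) Every sequence of (possibly randomized) tests $\psi_m:\mathcal Y^m\to[0,1]$ (measurable) with $\limsup_m\mathbb E_{P_0^{\otimes m}}\psi_m\le\tau$ satisfies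 $$\limsup_{m\to\infty}\mathbb E_{Q_{\alpha_m}^{\otimes m}}\psi_m\ \le\ 1-\Phi(z_{1-\tau}-h).$$
   Context: $Y_1,\dots,Y_m$ are the coordinate variables on $\mathcal Y^m$. $o_{P_0}(1)$ denotes a sequence converging to $0$ in probability under $P_0^{\otimes m}$. $\Phi$ is the standard normal distribution function and $z_{1-\tau}=\Phi^{-1}(1-\tau)$. *)

theory Defs
  imports "HOL-Probability.Probability"
begin

text \<open>
  The measure \<open>(1 - \<alpha>) P + \<alpha> Q\<close> on the measurable space of \<open>P\<close>. The intended range is
  \<open>0 \<le> \<alpha> \<le> 1\<close>; outside of it, \<open>ennreal\<close> truncates the negative weight to \<open>0\<close>.
\<close>
definition mixture :: "real \<Rightarrow> 'a measure \<Rightarrow> 'a measure \<Rightarrow> 'a measure" where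
  "mixture \<alpha> P Q = measure_of (space P) (sets P)
     (\<lambda>A. ennreal (1 - \<alpha>) * emeasure P A + ennreal \<alpha> * emeasure Q A)"

lemma space_mixture [simp]: "space (mixture \<alpha> P Q) = space P"
  by (simp add: mixture_def)

lemma sets_mixture [simp, measurable_cong]: "sets (mixture \<alpha> P Q) = sets P"
  by (simp add: mixture_def)

lemma emeasure_mixture:
  assumes "sets Q = sets P" "A \<in> sets P"
  shows "emeasure (mixture \<alpha> P Q) A = ennreal (1 - \<alpha>) * emeasure P A + ennreal \<alpha> * emeasure Q A"
  unfolding mixture_def
proof (rule emeasure_measure_of_sigma)
  show "sigma_algebra (space P) (sets P)" ..
  show "positive (sets P) (\<lambda>A. ennreal (1 - \<alpha>) * emeasure P A + ennreal \<alpha> * emeasure Q A)"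
    by (simp add: positive_def)
  show "countably_additive (sets P)
      (\<lambda>A. ennreal (1 - \<alpha>) * emeasure P A + ennreal \<alpha> * emeasure Q A)"
  proof (rule countably_additiveI)
    fix B :: "nat \<Rightarrow> 'a set"
    assume B: "range B \<subseteq> sets P" "disjoint_family B"
    have B': "range B \<subseteq> sets Q"
      using B(1) assms(1) by simp
    have "(\<Sum>i. ennreal (1 - \<alpha>) * emeasure P (B i) + ennreal \<alpha> * emeasure Q (B i)) =
        (\<Sum>i. ennreal (1 - \<alpha>) * emeasure P (B i)) + (\<Sum>i. ennreal \<alpha> * emeasure Q (B i))"
      by (rule suminf_add[symmetric]) (rule summableI)+
    also have "\<dots> = ennreal (1 - \<alpha>) * (\<Sum>i. emeasure P (B i)) + ennreal \<alpha> * (\<Sum>i. emeasure Q (B i))"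
      by (simp only: ennreal_suminf_cmult)
    also have "\<dots> = ennreal (1 - \<alpha>) * emeasure P (\<Union>i. B i) + ennreal \<alpha> * emeasure Q (\<Union>i. B i)"
      by (simp only: suminf_emeasure[OF B] suminf_emeasure[OF B' B(2)])
    finally show "(\<Sum>i. ennreal (1 - \<alpha>) * emeasure P (B i) + ennreal \<alpha> * emeasure Q (B i)) =
        ennreal (1 - \<alpha>) * emeasure P (\<Union>i. B i) + ennreal \<alpha> * emeasure Q (\<Union>i. B i)" .
  qed
qed (use assms in auto)

lemma prob_space_mixture:
  assumes "prob_space P" "prob_space Q" "sets Q = sets P" "0 \<le> \<alpha>" "\<alpha> \<le> 1"
  shows "prob_space (mixture \<alpha> P Q)"
proof
  have "emeasure Q (space P) = 1"
    using assms(2,3) by (metis prob_space.emeasure_space_1 sets_eq_imp_space_eq)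
  then have "emeasure (mixture \<alpha> P Q) (space P) = ennreal (1 - \<alpha>) + ennreal \<alpha>"
    using assms by (simp add: emeasure_mixture prob_space.emeasure_space_1)
  also have "\<dots> = 1"
    using assms(4,5) by (simp flip: ennreal_plus)
  finally show "emeasure (mixture \<alpha> P Q) (space (mixture \<alpha> P Q)) = 1"
    by simp
qed

text \<open>The product \<open>P\<^sup>m\<close>; the coordinate variables are \<open>\<lambda>y. y i\<close> for \<open>i < m\<close>.\<close>
definition prod_power :: "'a measure \<Rightarrow> nat \<Rightarrow> (nat \<Rightarrow> 'a) measure" where
  "prod_power P m = PiM {..<m} (\<lambda>_. P)"

text \<open>
  \<open>X m = o(1)\<close> in probability under \<open>M m\<close>, the probability space being allowed to vary with \<open>m\<close>.
  Measurability is required because \<open>measure\<close> is \<open>0\<close> on non-measurable sets.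
\<close>
definition vanishes_in_prob :: "(nat \<Rightarrow> 'a measure) \<Rightarrow> (nat \<Rightarrow> 'a \<Rightarrow> real) \<Rightarrow> bool" where
  "vanishes_in_prob M X \<longleftrightarrow>
     (\<forall>m. X m \<in> borel_measurable (M m)) \<and>
     (\<forall>\<delta>>0. (\<lambda>m. measure (M m) {y \<in> space (M m). \<bar>X m y\<bar> > \<delta>}) \<longlonglongrightarrow> 0)"

definition std_normal_cdf :: "real \<Rightarrow> real" where
  "std_normal_cdf = cdf std_normal_distribution"

definition std_normal_quantile :: "real \<Rightarrow> real" where
  "std_normal_quantile = inv std_normal_cdf"

end

theory Submission
  imports Defs "HOL-Real_Asymp.Real_Asymp"
begin

text \<open>
  Put \<open>b = h / (\<rho> \<surd>m)\<close> and let \<open>L\<close> be the likelihood ratio, the product of the \<open>1 + b g(Y\<^sub>i)\<close>.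

  (i) Write \<open>ln (1 + x) = x + d(x)\<close> and cut \<open>d\<close> off outside \<open>\<bar>x\<bar> \<le> 1/2\<close>. By dominated convergence with a
  multiple of \<open>g\<^sup>2\<close> as majorant, \<open>m E d(b g) \<rightarrow> - h\<^sup>2/2\<close>, \<open>m E d(b g)\<^sup>2 \<rightarrow> 0\<close> and
  \<open>m P(\<bar>b g\<bar> > 1/2) \<rightarrow> 0\<close>, so Chebyshev's inequality and a union bound suffice.

  (ii), (iii) The characteristic function of \<open>Z\<^sub>m\<close> under the mixture is an \<open>m\<close>-th power of
  \<open>E ((1 + b g) exp (i t g / (\<rho> \<surd>m)))\<close>, which is \<open>1 + (i h t - t\<^sup>2/2 + o(1)) / m\<close>; this treats the
  null (\<open>b = 0\<close>) and the local alternatives alike, without contiguity.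

  (iv) For every \<open>k \<ge> 0\<close>, \<open>E\<^sub>Q \<psi> \<le> k E\<^sub>0 \<psi> + E\<^sub>0 (L - k)\<^sup>+ = k E\<^sub>0 \<psi> + 1 - k + E\<^sub>0 (k - L)\<^sup>+\<close>. The
  function \<open>(k - L)\<^sup>+\<close> is bounded and Lipschitz in \<open>ln L\<close>, so by (i) and the central limit theorem its
  expectation converges. Take \<open>k = exp (h z - h\<^sup>2/2)\<close> with \<open>z\<close> the \<open>(1 - \<tau>)\<close>-quantile.
\<close>

subsection \<open>Finite powers of a probability space\<close>

lemma space_prod_power: "space (prod_power P m) = (\<Pi>\<^sub>E i\<in>{..<m}. space P)"
  by (simp add: prod_power_def space_PiM)

lemma measurable_prod_power_component:
  "i < m \<Longrightarrow> f \<in> measurable P N \<Longrightarrow> (\<lambda>y. f (y i)) \<in> measurable (prod_power P m) N"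
  unfolding prod_power_def
  by (rule measurable_compose[OF measurable_component_singleton]) auto

lemma borel_measurable_sum_prod_power:
  fixes f :: "'a \<Rightarrow> real"
  assumes "f \<in> borel_measurable P"
  shows "(\<lambda>y. \<Sum>i<m. f (y i)) \<in> borel_measurable (prod_power P m)"
  using assms by (intro borel_measurable_sum measurable_prod_power_component) auto

lemma borel_measurable_prod_prod_power:
  fixes f :: "'a \<Rightarrow> real"
  assumes "f \<in> borel_measurable P"
  shows "(\<lambda>y. \<Prod>i<m. f (y i)) \<in> borel_measurable (prod_power P m)"
  using assms by (intro borel_measurable_prod measurable_prod_power_component) auto

context prob_space
begin

lemma prob_space_prod_power: "prob_space (prod_power M m)"
  unfolding prod_power_def by (intro prob_space_PiM prob_space_axioms)

lemma distr_prod_power_component: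
  "i < m \<Longrightarrow> distr (prod_power M m) M (\<lambda>y. y i) = M"
  unfolding prod_power_def
  using distr_PiM_component[of "{..<m}" "\<lambda>_. M" i] prob_space_axioms by auto

lemma AE_prod_power_component:
  "i < m \<Longrightarrow> AE x in M. Q x \<Longrightarrow> AE y in prod_power M m. Q (y i)"
  unfolding prod_power_def
  using AE_PiM_component[of "{..<m}" "\<lambda>_. M" i] prob_space_axioms by auto

lemma integral_prod_power_component:
  fixes f :: "'a \<Rightarrow> 'b::{banach, second_countable_topology}"
  assumes "i < m" "f \<in> borel_measurable M"
  shows "(\<integral>y. f (y i) \<partial>prod_power M m) = integral\<^sup>L M f"
proof -
  have "(\<lambda>y. y i) \<in> measurable (prod_power M m) M"
    using measurable_prod_power_component[OF assms(1), of "\<lambda>x. x" M M] by simp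
  from integral_distr[OF this assms(2)] show ?thesis
    by (simp add: distr_prod_power_component assms)
qed

lemma integrable_prod_power_component:
  fixes f :: "'a \<Rightarrow> 'b::{banach, second_countable_topology}"
  assumes "i < m" "integrable M f"
  shows "integrable (prod_power M m) (\<lambda>y. f (y i))"
proof -
  have "(\<lambda>y. y i) \<in> measurable (prod_power M m) M"
    using measurable_prod_power_component[OF assms(1), of "\<lambda>x. x" M M] by simp
  from integrable_distr[OF this, of f] show ?thesis
    by (simp add: distr_prod_power_component assms)
qed

section \<open>Products and squared sums of independent coordinates\<close>

lemma product_sigma_finite_const: "product_sigma_finite (\<lambda>_. M)"
  by (simp add: product_sigma_finite_def sigma_finite_measure_axioms)

lemma integral_prod_prod_power:
  fixes f :: "nat \<Rightarrow> 'a \<Rightarrow> 'b::{real_normed_field, banach, second_countable_topology}"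
  assumes "\<And>i. i < m \<Longrightarrow> integrable M (f i)"
  shows "(\<integral>y. (\<Prod>i<m. f i (y i)) \<partial>prod_power M m) = (\<Prod>i<m. integral\<^sup>L M (f i))"
  unfolding prod_power_def
  by (rule product_sigma_finite.product_integral_prod[OF product_sigma_finite_const])
     (use assms in auto)

lemma integrable_prod_prod_power:
  fixes f :: "nat \<Rightarrow> 'a \<Rightarrow> 'b::{real_normed_field, banach, second_countable_topology}"
  assumes "\<And>i. i < m \<Longrightarrow> integrable M (f i)"
  shows "integrable (prod_power M m) (\<lambda>y. \<Prod>i<m. f i (y i))"
  unfolding prod_power_def
  by (rule product_sigma_finite.product_integrable_prod[OF product_sigma_finite_const])
     (use assms in auto)

text \<open>Padding the two factors with the constant 1 at all other coordinates reduces this to the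
  product rule over all \<open>m\<close> coordinates.\<close>

lemma
  fixes f g :: "'a \<Rightarrow> real"
  assumes ij: "i < m" "j < m" "i \<noteq> j" and f: "integrable M f" and g: "integrable M g"
  shows integrable_mult_prod_power: "integrable (prod_power M m) (\<lambda>y. f (y i) * g (y j))" (is ?I)
    and integral_mult_prod_power:
      "(\<integral>y. f (y i) * g (y j) \<partial>prod_power M m) = integral\<^sup>L M f * integral\<^sup>L M g" (is ?E)
proof -
  define F where "F k = (if k = i then f else if k = j then g else (\<lambda>_. 1))" for k
  have F: "integrable M (F k)" for k
    using f g by (simp add: F_def)
  have *: "(\<Prod>k<m. c k) = c i * c j" if "\<And>k. k < m \<Longrightarrow> k \<noteq> i \<Longrightarrow> k \<noteq> j \<Longrightarrow> c k = 1"
    for c :: "nat \<Rightarrow> real"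
  proof -
    have "(\<Prod>k<m. c k) = (\<Prod>k\<in>{i, j}. c k)"
      using ij that by (intro prod.mono_neutral_right) auto
    then show ?thesis using ij by simp
  qed
  have prod: "(\<Prod>k<m. F k (y k)) = f (y i) * g (y j)" for y
    by (subst *) (use ij in \<open>auto simp: F_def\<close>)
  have "(\<Prod>k<m. integral\<^sup>L M (F k)) = integral\<^sup>L M f * integral\<^sup>L M g"
    by (subst *) (use ij in \<open>auto simp: F_def prob_space\<close>)
  with integral_prod_prod_power[of m F] integrable_prod_prod_power[of m F] F
  show ?I ?E by (simp_all add: prod)
qed

text \<open>Expanding the square gives a double sum in which the off-diagonal terms vanish, by
  independence and because \<open>f\<close> has mean zero.\<close>

lemma
  fixes f :: "'a \<Rightarrow> real"
  assumes f: "integrable M f" "integrable M (\<lambda>x. (f x)\<^sup>2)" and mean: "expectation f = 0"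
  shows integrable_sum_square_prod_power:
      "integrable (prod_power M m) (\<lambda>y. (\<Sum>i<m. f (y i))\<^sup>2)" (is ?I)
    and integral_sum_square_prod_power:
      "(\<integral>y. (\<Sum>i<m. f (y i))\<^sup>2 \<partial>prod_power M m) = m * expectation (\<lambda>x. (f x)\<^sup>2)" (is ?E)
proof -
  have sq: "(\<Sum>i<m. f (y i))\<^sup>2 = (\<Sum>i<m. \<Sum>j<m. f (y i) * f (y j))" for y :: "nat \<Rightarrow> 'a"
    by (simp add: power2_eq_square sum_product)
  have int: "integrable (prod_power M m) (\<lambda>y. f (y i) * f (y j))" if "i < m" "j < m" for i j
  proof (cases "i = j")
    case True
    then show ?thesis
      using integrable_prod_power_component[OF that(1) f(2)] by (simp add: power2_eq_square)
  qed (use that f integrable_mult_prod_power in auto)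
  have val: "(\<integral>y. f (y i) * f (y j) \<partial>prod_power M m) =
      (if i = j then expectation (\<lambda>x. (f x)\<^sup>2) else 0)" if "i < m" "j < m" for i j
  proof (cases "i = j")
    case True
    then show ?thesis
      using integral_prod_power_component[OF that(1), of "\<lambda>x. (f x)\<^sup>2"] f(2)
      by (simp add: power2_eq_square)
  qed (use that f mean integral_mult_prod_power in auto)
  show ?I
    unfolding sq by (intro Bochner_Integration.integrable_sum int) auto
  have "(\<integral>y. (\<Sum>i<m. f (y i))\<^sup>2 \<partial>prod_power M m) =
      (\<Sum>i<m. \<Sum>j<m. \<integral>y. f (y i) * f (y j) \<partial>prod_power M m)"
    unfolding sq by (subst Bochner_Integration.integral_sum,
      auto intro!: Bochner_Integration.integrable_sum int sum.cong Bochner_Integration.integral_sum)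
  also have "\<dots> = (\<Sum>i<m. \<Sum>j<m. if i = j then expectation (\<lambda>x. (f x)\<^sup>2) else 0)"
    by (intro sum.cong refl val) auto
  also have "\<dots> = m * expectation (\<lambda>x. (f x)\<^sup>2)"
    by simp
  finally show ?E .
qed

text \<open>The product measure is determined by its values on boxes. The indicator of a box
  factorizes over coordinates just as the density does, so the integral over a box splits into
  one-dimensional ones.\<close>

lemma prod_power_density:
  assumes f: "f \<in> borel_measurable M" and D: "prob_space (density M f)"
  shows "prod_power (density M f) m = density (prod_power M m) (\<lambda>y. \<Prod>i<m. f (y i))"
proof -
  interpret D: prob_space "density M f" by fact
  interpret PM: product_sigma_finite "\<lambda>_::nat. M" by (rule product_sigma_finite_const)
  interpret PD: product_sigma_finite "\<lambda>_::nat. density M f" by (rule D.product_sigma_finite_const)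
  have "density (PiM {..<m} (\<lambda>_. M)) (\<lambda>y. \<Prod>i<m. f (y i)) = PiM {..<m} (\<lambda>_. density M f)"
  proof (rule PD.PiM_eqI)
    show "sets (density (PiM {..<m} (\<lambda>_. M)) (\<lambda>y. \<Prod>i<m. f (y i))) =
        sets (PiM {..<m} (\<lambda>_. density M f))"
      by (simp cong: sets_PiM_cong)
  next
    fix A :: "nat \<Rightarrow> 'a set"
    assume "\<And>i. i \<in> {..<m} \<Longrightarrow> A i \<in> sets (density M f)"
    then have A: "A i \<in> sets M" if "i < m" for i using that by auto
    have [measurable]: "(\<lambda>y. \<Prod>i<m. f (y i)) \<in> borel_measurable (PiM {..<m} (\<lambda>_. M))"
      using f by (intro borel_measurable_prod_ennreal
        measurable_compose[OF measurable_component_singleton]) auto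
    have "emeasure (density (PiM {..<m} (\<lambda>_. M)) (\<lambda>y. \<Prod>i<m. f (y i))) (Pi\<^sub>E {..<m} A)
      = (\<integral>\<^sup>+y. (\<Prod>i<m. f (y i)) * indicator (Pi\<^sub>E {..<m} A) y \<partial>PiM {..<m} (\<lambda>_. M))"
      using A by (intro emeasure_density) (auto intro!: sets_PiM_I_finite)
    also have "\<dots> = (\<integral>\<^sup>+y. (\<Prod>i<m. f (y i) * indicator (A i) (y i)) \<partial>PiM {..<m} (\<lambda>_. M))"
    proof (rule nn_integral_cong)
      fix y assume y: "y \<in> space (PiM {..<m} (\<lambda>_. M))"
      \<comment> \<open>Since \<open>y\<close> lies in the product space it is already extensional,
        so membership in the box depends on the coordinates below \<open>m\<close> only.\<close>
      have "indicator (Pi\<^sub>E {..<m} A) y = (\<Prod>i<m. indicator (A i) (y i) :: ennreal)"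
      proof (cases "y \<in> Pi\<^sub>E {..<m} A")
        case False
        then obtain i where "i < m" "y i \<notin> A i"
          using y by (auto simp: space_PiM PiE_iff)
        then have "(\<Prod>i<m. indicator (A i) (y i) :: ennreal) = 0"
          by (intro prod_zero) (auto intro!: bexI[of _ i])
        with False show ?thesis by simp
      next
        case True
        then have "(\<Prod>i<m. indicator (A i) (y i) :: ennreal) = 1"
          by (intro prod.neutral) (auto simp: PiE_iff)
        with True show ?thesis by simp
      qed
      then show "(\<Prod>i<m. f (y i)) * indicator (Pi\<^sub>E {..<m} A) y =
          (\<Prod>i<m. f (y i) * indicator (A i) (y i))"
        by (simp add: prod.distrib)
    qed
    also have "\<dots> = (\<Prod>i<m. \<integral>\<^sup>+x. f x * indicator (A i) x \<partial>M)"
      using A f by (intro PM.product_nn_integral_prod) auto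
    also have "\<dots> = (\<Prod>i<m. emeasure (density M f) (A i))"
      using A f by (intro prod.cong refl emeasure_density[symmetric]) auto
    finally show "emeasure (density (PiM {..<m} (\<lambda>_. M)) (\<lambda>y. \<Prod>i<m. f (y i))) (Pi\<^sub>E {..<m} A)
      = (\<Prod>i<m. emeasure (density M f) (A i))" .
  qed auto
  then show ?thesis by (simp add: prod_power_def)
qed

end

subsection \<open>Expansions of characteristic functions\<close>

lemma tendsto_divide_sqrt_0: "(\<lambda>m. u / sqrt (real m)) \<longlonglongrightarrow> 0"
  by real_asymp

lemma tendsto_norm_bound:
  fixes f :: "_ \<Rightarrow> 'b::real_normed_vector"
  assumes "\<forall>\<^sub>F x in F. norm (a - f x) \<le> e x" "(e \<longlongrightarrow> 0) F"
  shows "(f \<longlongrightarrow> a) F"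
  using Lim_null_comparison[of "\<lambda>x. f x - a" e F] assms
  by (auto simp: norm_minus_commute intro: LIM_zero_cancel)

text \<open>Orders 0, 1 and 2 of the Taylor remainder estimate for the exponential on the imaginary
  axis.\<close>

lemma iexp_bounds:
  shows iexp_minus_1_bound: "cmod (iexp x - 1) \<le> \<bar>x\<bar>"
    and iexp_minus_linear_bound: "cmod (iexp x - 1 - \<i> * x) \<le> x\<^sup>2 / 2"
    and iexp_minus_quadratic_bound: "cmod (iexp x - 1 - \<i> * x + x\<^sup>2 / 2) \<le> \<bar>x\<bar> ^ 3 / 6"
proof -
  show "cmod (iexp x - 1) \<le> \<bar>x\<bar>"
    using iexp_approx1[of x 0] by simp
  show "cmod (iexp x - 1 - \<i> * x) \<le> x\<^sup>2 / 2"
    using iexp_approx1[of x 1] by (simp add: diff_diff_eq numeral_2_eq_2)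
  have "(\<i> * x)^2 = - (complex_of_real x)\<^sup>2"
    by (simp add: power_mult_distrib)
  then show "cmod (iexp x - 1 - \<i> * x + x\<^sup>2 / 2) \<le> \<bar>x\<bar> ^ 3 / 6"
    using iexp_approx1[of x 2]
    by (simp add: numeral_2_eq_2 numeral_3_eq_3 fact_numeral algebra_simps)
qed

text \<open>This factor multiplies the tilt of size \<open>1 / sqrt m\<close> in the one-observation
  characteristic function; it produces the shift term \<open>i h t\<close> of the limit.\<close>

lemma tendsto_iexp_first_order:
  "(\<lambda>m. of_real (sqrt (real m)) * (iexp (u / sqrt (real m)) - 1)) \<longlonglongrightarrow> \<i> * complex_of_real u"
proof (rule tendsto_norm_bound)
  show "\<forall>\<^sub>F m in sequentially. norm (\<i> * complex_of_real u -
      of_real (sqrt (real m)) * (iexp (u / sqrt (real m)) - 1)) \<le> (u\<^sup>2 / 2) / sqrt (real m)"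
    using eventually_gt_at_top[of 0]
  proof eventually_elim
    case (elim m)
    let ?s = "sqrt (real m)"
    have s: "?s > 0" using elim by simp
    have "\<i> * complex_of_real u - of_real ?s * (iexp (u / ?s) - 1) =
        - of_real ?s * (iexp (u / ?s) - 1 - \<i> * (u / ?s))"
      using s by (simp add: field_simps)
    then have "norm (\<i> * complex_of_real u - of_real ?s * (iexp (u / ?s) - 1)) =
        ?s * cmod (iexp (u / ?s) - 1 - \<i> * (u / ?s))"
      using s by (simp only: norm_mult norm_minus_cancel norm_of_real abs_of_pos)
    also have "\<dots> \<le> ?s * ((u / ?s)\<^sup>2 / 2)"
      using s by (intro mult_left_mono iexp_minus_linear_bound) auto
    also have "\<dots> = (u\<^sup>2 / 2) / ?s"
      using s by (simp add: field_simps power2_eq_square)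
    finally show ?case .
  qed
  show "(\<lambda>m. (u\<^sup>2 / 2) / sqrt (real m)) \<longlonglongrightarrow> 0" by (rule tendsto_divide_sqrt_0)
qed

text \<open>The quadratic term survives multiplication by \<open>m\<close>, while the cubic
  remainder is still of order \<open>1 / sqrt m\<close>. It produces the Gaussian term
  \<open>- t^2 / 2\<close>.\<close>

lemma tendsto_iexp_second_order:
  "(\<lambda>m. of_nat m * (iexp (u / sqrt (real m)) - 1 - \<i> * complex_of_real (u / sqrt (real m))))
     \<longlonglongrightarrow> - (complex_of_real u)\<^sup>2 / 2"
proof (rule tendsto_norm_bound)
  show "\<forall>\<^sub>F m in sequentially. norm (- (complex_of_real u)\<^sup>2 / 2 -
      of_nat m * (iexp (u / sqrt (real m)) - 1 - \<i> * complex_of_real (u / sqrt (real m))))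
        \<le> (\<bar>u\<bar> ^ 3 / 6) / sqrt (real m)"
    using eventually_gt_at_top[of 0]
  proof eventually_elim
    case (elim m)
    let ?s = "sqrt (real m)"
    have s: "?s > 0" using elim by simp
    have ms: "real m = ?s * ?s" by simp
    have cms: "of_nat m * (complex_of_real (u / ?s))\<^sup>2 = (complex_of_real u)\<^sup>2"
    proof -
      have "real m * (u / ?s)\<^sup>2 = u\<^sup>2"
        using s by (simp add: power_divide)
      then show ?thesis
        by (metis of_real_mult of_real_of_nat_eq of_real_power)
    qed
    have "- (complex_of_real u)\<^sup>2 / 2 - of_nat m * (iexp (u / ?s) - 1 - \<i> * complex_of_real (u / ?s)) =
        - of_nat m * (iexp (u / ?s) - 1 - \<i> * complex_of_real (u / ?s) + (u / ?s)\<^sup>2 / 2)"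
      unfolding cms[symmetric] by (simp add: algebra_simps)
    then have "norm (- (complex_of_real u)\<^sup>2 / 2 -
          of_nat m * (iexp (u / ?s) - 1 - \<i> * complex_of_real (u / ?s))) =
        real m * cmod (iexp (u / ?s) - 1 - \<i> * complex_of_real (u / ?s) + (u / ?s)\<^sup>2 / 2)"
      by (simp only: norm_mult norm_minus_cancel norm_of_nat)
    also have "\<dots> \<le> real m * (\<bar>u / ?s\<bar> ^ 3 / 6)"
      by (intro mult_left_mono iexp_minus_quadratic_bound) auto
    also have "\<dots> = (\<bar>u\<bar> ^ 3 / 6) / ?s"
      using s by (subst ms) (simp add: power_divide field_simps power3_eq_cube del: real_sqrt_mult_self)
    finally show ?case .
  qed
  show "(\<lambda>m. (\<bar>u\<bar> ^ 3 / 6) / sqrt (real m)) \<longlonglongrightarrow> 0" by (rule tendsto_divide_sqrt_0)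
qed

text \<open>Comparison with \<open>w m = exp (c / m)\<close>: in the closed unit disc,
  \<open>m\<close>-th powers differ by at most \<open>m\<close> times the difference of the bases,
  and both bases are \<open>1 + c / m + o(1 / m)\<close>.\<close>

lemma tendsto_power_exp:
  fixes z :: "nat \<Rightarrow> complex"
  assumes z: "\<And>m. norm (z m) \<le> 1" and c: "Re c \<le> 0"
    and lim: "(\<lambda>m. of_nat m * (z m - 1)) \<longlonglongrightarrow> c"
  shows "(\<lambda>m. z m ^ m) \<longlonglongrightarrow> exp c"
proof -
  define w where "w m = exp (c / of_nat m)" for m
  \<comment> \<open>The sign of \<open>Re c\<close> puts \<open>w m\<close> in the unit disc, as the
    comparison of powers demands.\<close>
  have w1: "norm (w m) \<le> 1" for m
    using c by (simp add: w_def Re_divide_of_nat divide_nonpos_nonneg)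
  have wm: "w m ^ m = exp c" if "m > 0" for m
    using that by (simp add: w_def flip: exp_of_nat_mult)
  have "(\<lambda>m. of_nat m * (w m - 1)) \<longlonglongrightarrow> c"
  proof (rule tendsto_norm_bound)
    show "\<forall>\<^sub>F m in sequentially. norm (c - of_nat m * (w m - 1)) \<le> exp (norm c) * (norm c)\<^sup>2 / real m"
      using eventually_gt_at_top[of 0]
    proof eventually_elim
      case (elim m)
      have m: "real m > 0" using elim by simp
      have "norm (exp (c / of_nat m) - (\<Sum>k\<le>1. (c / of_nat m) ^ k / fact k)) \<le>
          exp (norm (c / of_nat m)) * norm (c / of_nat m) ^ Suc 1 / fact 1"
        by (rule Taylor_exp_field)
      then have "norm (exp (c / of_nat m) - 1 - c / of_nat m) \<le>
          exp (norm c / m) * (norm c / m)\<^sup>2"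
        by (simp add: norm_divide diff_diff_eq power2_eq_square)
      \<comment> \<open>As \<open>m >= 1\<close>, the exponential factor is bounded uniformly in
        \<open>m\<close>.\<close>
      moreover have "exp (norm c / m) \<le> exp (norm c)"
        using elim by (simp add: divide_le_eq mult_le_cancel_left1)
      ultimately have b: "norm (exp (c / of_nat m) - 1 - c / of_nat m) \<le>
          exp (norm c) * (norm c / m)\<^sup>2"
        by (meson mult_right_mono order_trans zero_le_power2)
      have "c - of_nat m * (w m - 1) = - of_nat m * (exp (c / of_nat m) - 1 - c / of_nat m)"
      proof -
        have "of_nat m * (c / of_nat m) = c" using elim by simp
        then show ?thesis by (simp add: w_def right_diff_distrib)
      qed
      then have "norm (c - of_nat m * (w m - 1)) =
          m * norm (exp (c / of_nat m) - 1 - c / of_nat m)"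
        by (simp only: norm_mult norm_minus_cancel norm_of_nat)
      also have "\<dots> \<le> m * (exp (norm c) * (norm c / m)\<^sup>2)"
        using b by (intro mult_left_mono) auto
      also have "\<dots> = exp (norm c) * (norm c)\<^sup>2 / m"
        using m by (simp add: field_simps power2_eq_square)
      finally show ?case .
    qed
    show "(\<lambda>m. exp (norm c) * (norm c)\<^sup>2 / real m) \<longlonglongrightarrow> 0" by real_asymp
  qed
  from tendsto_diff[OF lim this]
  have "(\<lambda>m. norm (of_nat m * (z m - w m))) \<longlonglongrightarrow> 0"
    by (intro tendsto_norm_zero) (simp add: algebra_simps)
  moreover have "norm (z m ^ m - w m ^ m) \<le> norm (of_nat m * (z m - w m))" for m
    using norm_power_diff[OF z w1, of m m] by (simp add: norm_mult)
  ultimately have "(\<lambda>m. z m ^ m - w m ^ m) \<longlonglongrightarrow> 0"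
    by (intro Lim_null_comparison[of "\<lambda>m. z m ^ m - w m ^ m"]) auto
  moreover have "(\<lambda>m. w m ^ m) \<longlonglongrightarrow> exp c"
    \<comment> \<open>The identity starts at \<open>m = 1\<close>; at \<open>m = 0\<close> the power
      is 1 whatever \<open>c\<close> is.\<close>
    by (rule tendsto_eventually) (use wm in \<open>auto simp: eventually_sequentially intro: exI[of _ 1]\<close>)
  ultimately have "(\<lambda>m. (z m ^ m - w m ^ m) + w m ^ m) \<longlonglongrightarrow> 0 + exp c"
    by (rule tendsto_add)
  then show ?thesis by simp
qed

text \<open>Stated for an arbitrary probability space, so that it can be instantiated at the tilted
  measures as well.\<close>

lemma (in prob_space) char_distr_prod_power:
  fixes f :: "'a \<Rightarrow> real"
  assumes [measurable]: "f \<in> borel_measurable M"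
  shows "char (distr (prod_power M m) borel (\<lambda>y. c * (\<Sum>i<m. f (y i)))) t =
    (CLINT x|M. iexp (t * c * f x)) ^ m"
proof -
  have "(\<lambda>y. c * (\<Sum>i<m. f (y i))) \<in> borel_measurable (prod_power M m)"
    using borel_measurable_sum_prod_power[OF assms] by measurable
  then have "char (distr (prod_power M m) borel (\<lambda>y. c * (\<Sum>i<m. f (y i)))) t =
      (CLINT y|prod_power M m. iexp (t * (c * (\<Sum>i<m. f (y i)))))"
    by (simp add: char_def integral_distr)
  also have "\<dots> = (CLINT y|prod_power M m. \<Prod>i<m. iexp (t * c * f (y i)))"
    by (simp add: exp_sum[symmetric] sum_distrib_left mult_ac)
  also have "\<dots> = (\<Prod>i<m. CLINT x|M. iexp (t * c * f x))"
    by (intro integral_prod_prod_power integrable_iexp) auto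
  finally show ?thesis by simp
qed

text \<open>
  Only \<open>g = dP\<^sub>1/dP\<^sub>0 - 1\<close> matters for the local analysis; \<open>tilted a\<close> below is the mixture \<open>Q\<^sub>a\<close>.
\<close>
locale score = prob_space +
  fixes g :: "'a \<Rightarrow> real" and \<rho> :: real
  assumes g_measurable [measurable]: "g \<in> borel_measurable M"
    and g_square_integrable: "integrable M (\<lambda>x. (g x)\<^sup>2)"
    and g_mean: "expectation g = 0"
    and g_second_moment: "expectation (\<lambda>x. (g x)\<^sup>2) = \<rho>\<^sup>2"
    and \<rho>_pos: "\<rho> > 0"
    and g_ge: "AE x in M. - 1 \<le> g x"
begin

definition Z :: "nat \<Rightarrow> (nat \<Rightarrow> 'a) \<Rightarrow> real" where
  "Z m y = (1 / (\<rho> * sqrt (real m))) * (\<Sum>i<m. g (y i))"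

definition tilted :: "real \<Rightarrow> 'a measure" where
  "tilted a = density M (\<lambda>x. ennreal (1 + a * g x))"

lemma g_integrable: "integrable M g"
  by (rule square_integrable_imp_integrable[OF g_measurable g_square_integrable])

lemma Z_measurable: "Z m \<in> borel_measurable (prod_power M m)"
  unfolding Z_def[abs_def] using borel_measurable_sum_prod_power[OF g_measurable] by measurable

lemma sets_tilted [simp, measurable_cong]: "sets (tilted a) = sets M"
  by (simp add: tilted_def)

lemma space_tilted [simp]: "space (tilted a) = space M"
  by (simp add: tilted_def)

lemma sets_prod_power_tilted [simp, measurable_cong]:
  "sets (prod_power (tilted a) m) = sets (prod_power M m)"
  unfolding prod_power_def by (intro sets_PiM_cong) auto

lemma space_prod_power_tilted [simp]:
  "space (prod_power (tilted a) m) = space (prod_power M m)"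
  by (simp add: space_prod_power)

lemma tilted_0: "tilted 0 = M"
  by (simp add: tilted_def density_1)

lemma AE_density_nonneg:
  assumes "0 \<le> a" "a \<le> 1"
  shows "AE x in M. 0 \<le> 1 + a * g x"
  using g_ge
proof eventually_elim
  case (elim x)
  have "a * (- 1) \<le> a * g x" using elim assms by (intro mult_left_mono) auto
  with assms show ?case by simp
qed

lemma prob_space_tilted:
  assumes "0 \<le> a" "a \<le> 1"
  shows "prob_space (tilted a)"
proof
  have "emeasure (tilted a) (space M) = (\<integral>\<^sup>+x. ennreal (1 + a * g x) \<partial>M)"
    by (simp add: tilted_def emeasure_density cong: nn_integral_cong)
  also have "\<dots> = ennreal (\<integral>x. 1 + a * g x \<partial>M)"
    by (intro nn_integral_eq_integral AE_density_nonneg assms) (use g_integrable in simp)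
  also have "(\<integral>x. 1 + a * g x \<partial>M) = 1"
    using g_integrable by (simp add: g_mean prob_space)
  finally show "emeasure (tilted a) (space (tilted a)) = 1"
    by simp
qed

text \<open>Because \<open>g\<close> has mean zero, the terms \<open>i s g\<close> and
  \<open>a g\<close> can be subtracted under the integral without changing it. What remains is of
  second order in \<open>g\<close>, hence fit for domination by \<open>g^2\<close>.\<close>

lemma CLINT_tilted_iexp:
  assumes "0 \<le> a" "a \<le> 1"
  shows "(CLINT x|tilted a. iexp (s * g x)) - 1 =
    (CLINT x|M. (iexp (s * g x) - 1 - \<i> * of_real (s * g x)) + of_real (a * g x) * (iexp (s * g x) - 1))"
proof -
  have 1: "integrable M (\<lambda>x. iexp (s * g x))"
    by (intro integrable_iexp) auto
  have 2: "integrable M (\<lambda>x. complex_of_real (g x))"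
    using g_integrable by simp
  have 3: "integrable M (\<lambda>x. of_real (g x) * iexp (s * g x))"
    by (rule Bochner_Integration.integrable_bound[OF g_integrable]) (auto simp: norm_mult)
  have "(CLINT x|tilted a. iexp (s * g x)) = (CLINT x|M. (1 + a * g x) *\<^sub>R iexp (s * g x))"
    unfolding tilted_def by (intro integral_density AE_density_nonneg assms) auto
  also have "\<dots> = (CLINT x|M. iexp (s * g x) + of_real a * (of_real (g x) * iexp (s * g x)))"
    by (intro Bochner_Integration.integral_cong) (auto simp: scaleR_conv_of_real algebra_simps)
  also have "\<dots> = (CLINT x|M. iexp (s * g x)) + of_real a * (CLINT x|M. of_real (g x) * iexp (s * g x))"
    using 1 3 by simp
  finally have *: "(CLINT x|tilted a. iexp (s * g x)) =
      (CLINT x|M. iexp (s * g x)) + of_real a * (CLINT x|M. of_real (g x) * iexp (s * g x))" .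
  have "(CLINT x|M. (iexp (s * g x) - 1 - \<i> * of_real (s * g x)) + of_real (a * g x) * (iexp (s * g x) - 1)) =
     (CLINT x|M. iexp (s * g x) + of_real a * (of_real (g x) * iexp (s * g x))
        - (1 + (\<i> * of_real s + of_real a) * of_real (g x)))"
    by (intro Bochner_Integration.integral_cong) (auto simp: algebra_simps)
  also have "\<dots> = (CLINT x|M. iexp (s * g x)) + of_real a * (CLINT x|M. of_real (g x) * iexp (s * g x))
      - (1 + (\<i> * of_real s + of_real a) * (CLINT x|M. of_real (g x)))"
    using 1 2 3 by (simp add: prob_space)
  also have "(CLINT x|M. of_real (g x)) = 0"
    using g_mean by simp
  finally show ?thesis unfolding * by simp
qed

text \<open>
  Multiplied by \<open>m\<close>, the integrand is dominated by a multiple of \<open>g\<^sup>2\<close>, so second moments suffice.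
\<close>
lemma tendsto_char_expansion:
  assumes h: "0 \<le> h"
  shows "(\<lambda>m. of_nat m * (CLINT x|M.
      (iexp (t / (\<rho> * sqrt m) * g x) - 1 - \<i> * of_real (t / (\<rho> * sqrt m) * g x))
      + of_real (h / (\<rho> * sqrt m) * g x) * (iexp (t / (\<rho> * sqrt m) * g x) - 1)))
    \<longlonglongrightarrow> - (of_real t)\<^sup>2 / 2 + \<i> * of_real (h * t)"
    (is "(\<lambda>m. of_nat m * (CLINT x|M. ?F m x)) \<longlonglongrightarrow> ?c")
proof -
  define u where "u x = t * g x / \<rho>" for x
  define v where "v x = h * g x / \<rho>" for x
  have [measurable]: "u \<in> borel_measurable M" "v \<in> borel_measurable M"
    by (auto simp: u_def[abs_def] v_def[abs_def])
  \<comment> \<open>Here \<open>u / sqrt m\<close> is the argument of \<open>iexp\<close> and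
    \<open>v / sqrt m\<close> the tilt. In the cross term one factor \<open>sqrt m\<close> cancels
    that of the tilt and the other stays with \<open>iexp - 1\<close>.\<close>
  define G where "G m x = of_nat m * (iexp (u x / sqrt m) - 1 - \<i> * of_real (u x / sqrt m))
      + of_real (v x) * (of_real (sqrt m) * (iexp (u x / sqrt m) - 1))" for m x
  have FG: "of_nat m * ?F m x = G m x" for m x
  proof -
    have arg: "t / (\<rho> * sqrt m) * g x = u x / sqrt m"
      by (simp add: u_def field_simps)
    have coeff: "of_nat m * complex_of_real (h / (\<rho> * sqrt m) * g x) = of_real (v x) * of_real (sqrt m)"
    proof -
      have "real m * (h / (\<rho> * sqrt m) * g x) = v x * sqrt m"
      proof (cases "m = 0")
        case False
        then have "real m / sqrt m = sqrt m" by (simp add: real_div_sqrt)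
        moreover have "real m * (h / (\<rho> * sqrt m) * g x) = v x * (real m / sqrt m)"
          by (simp add: v_def)
        ultimately show ?thesis by simp
      qed simp
      then show ?thesis by (metis of_real_mult of_real_of_nat_eq)
    qed
    show ?thesis
      unfolding G_def arg by (simp only: distrib_left mult.assoc[symmetric] coeff)
  qed
  have "(\<lambda>m. CLINT x|M. G m x) \<longlonglongrightarrow> (CLINT x|M. - (of_real (u x))\<^sup>2 / 2 + of_real (v x) * (\<i> * of_real (u x)))"
  proof (rule integral_dominated_convergence)
    show "integrable M (\<lambda>x. (t\<^sup>2 / \<rho>\<^sup>2 / 2 + \<bar>h * t\<bar> / \<rho>\<^sup>2) * (g x)\<^sup>2)"
      using g_square_integrable by simp
    show "AE x in M. (\<lambda>m. G m x) \<longlonglongrightarrow> - (of_real (u x))\<^sup>2 / 2 + of_real (v x) * (\<i> * of_real (u x))"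
      unfolding G_def
      by (intro AE_I2 tendsto_add tendsto_iexp_second_order tendsto_mult tendsto_const
        tendsto_iexp_first_order)
    show "AE x in M. norm (G m x) \<le> (t\<^sup>2 / \<rho>\<^sup>2 / 2 + \<bar>h * t\<bar> / \<rho>\<^sup>2) * (g x)\<^sup>2" for m
    proof (rule AE_I2, cases "m = 0")
      fix x assume "m \<noteq> 0"
      then have s: "sqrt m > 0" by simp
      have "norm (G m x) \<le> norm (of_nat m * (iexp (u x / sqrt m) - 1 - \<i> * of_real (u x / sqrt m)))
          + norm (of_real (v x) * (of_real (sqrt m) * (iexp (u x / sqrt m) - 1)))"
        unfolding G_def by (rule norm_triangle_ineq)
      also have "\<dots> = m * norm (iexp (u x / sqrt m) - 1 - \<i> * of_real (u x / sqrt m))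
          + \<bar>v x\<bar> * (sqrt m * norm (iexp (u x / sqrt m) - 1))"
        by (simp only: norm_mult norm_of_nat norm_of_real abs_of_pos[OF s])
      also have "\<dots> \<le> m * ((u x / sqrt m)\<^sup>2 / 2) + \<bar>v x\<bar> * (sqrt m * \<bar>u x / sqrt m\<bar>)"
        by (intro add_mono mult_left_mono iexp_minus_linear_bound iexp_minus_1_bound) auto
      also have "\<dots> = (u x)\<^sup>2 / 2 + \<bar>v x * u x\<bar>"
        using s by (simp add: power_divide abs_mult)
      also have "\<bar>v x * u x\<bar> = \<bar>h * t\<bar> / \<rho>\<^sup>2 * (g x)\<^sup>2"
      proof -
        have "v x * u x = h * t / \<rho>\<^sup>2 * (g x)\<^sup>2"
          by (simp add: u_def v_def power2_eq_square)
        then show ?thesis by (simp add: abs_mult)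
      qed
      also have "(u x)\<^sup>2 / 2 + \<bar>h * t\<bar> / \<rho>\<^sup>2 * (g x)\<^sup>2 = (t\<^sup>2 / \<rho>\<^sup>2 / 2 + \<bar>h * t\<bar> / \<rho>\<^sup>2) * (g x)\<^sup>2"
        by (simp add: u_def power_mult_distrib power_divide distrib_right)
      finally show "norm (G m x) \<le> (t\<^sup>2 / \<rho>\<^sup>2 / 2 + \<bar>h * t\<bar> / \<rho>\<^sup>2) * (g x)\<^sup>2" .
    qed (simp add: G_def)
  qed (auto simp: G_def)
  \<comment> \<open>The limit integrand is a constant multiple of \<open>g^2\<close>, so the second
    moment \<open>\<rho>^2\<close> cancels the denominator.\<close>
  also have "(CLINT x|M. - (of_real (u x))\<^sup>2 / 2 + of_real (v x) * (\<i> * of_real (u x))) =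
      (CLINT x|M. (?c / of_real (\<rho>\<^sup>2)) * of_real ((g x)\<^sup>2))"
  proof (intro Bochner_Integration.integral_cong refl)
    fix x
    have "- (T * G / R)\<^sup>2 / 2 + (H * G / R) * (\<i> * (T * G / R)) =
        ((- T\<^sup>2 / 2 + \<i> * (H * T)) / R\<^sup>2) * G\<^sup>2" for T G R H :: complex
      by (cases "R = 0") (simp_all add: field_simps power2_eq_square)
    from this[of "of_real t" "of_real (g x)" "of_real \<rho>" "of_real h"]
    show "- (of_real (u x))\<^sup>2 / 2 + of_real (v x) * (\<i> * of_real (u x)) =
        (?c / of_real (\<rho>\<^sup>2)) * of_real ((g x)\<^sup>2)"
      by (simp only: u_def v_def of_real_mult of_real_divide of_real_power)
  qed
  also have "\<dots> = (?c / of_real (\<rho>\<^sup>2)) * of_real (\<rho>\<^sup>2)"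
    by (simp only: integral_mult_right_zero integral_complex_of_real g_second_moment)
  also have "\<dots> = ?c"
    using \<rho>_pos by simp
  finally have "(\<lambda>m. CLINT x|M. G m x) \<longlonglongrightarrow> ?c" .
  moreover have "(CLINT x|M. G m x) = of_nat m * (CLINT x|M. ?F m x)" for m
    by (simp only: FG[symmetric] integral_mult_right_zero)
  ultimately show ?thesis by (simp only:)
qed

end

subsection \<open>Weak convergence under local alternatives\<close>

lemma real_distribution_normal:
  "0 < \<sigma> \<Longrightarrow> real_distribution (density lborel (normal_density \<mu> \<sigma>))"
proof -
  assume "0 < \<sigma>"
  then interpret prob_space "density lborel (normal_density \<mu> \<sigma>)"
    by (rule prob_space_normal_density)
  show ?thesis by standard auto
qed

text \<open>Allows the characteristic function and the distribution function of
  \<open>N(h, 1)\<close> to be read off from the standard normal ones.\<close>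

lemma normal_distribution_shift:
  "density lborel (normal_density h 1) = distr std_normal_distribution borel (\<lambda>x. h + x)"
proof -
  interpret real_distribution std_normal_distribution by (rule real_dist_normal_dist)
  have "distributed std_normal_distribution lborel (\<lambda>x. x) std_normal_density"
    by (auto simp: distributed_def intro!: measure_eqI simp: emeasure_distr)
  from normal_density_affine[OF this, of 1 h]
  show ?thesis by (simp add: distributed_def cong: distr_cong)
qed

text \<open>The shift by \<open>h\<close> contributes the factor \<open>iexp (t h)\<close>. The
  exponent is written exactly as the limit in \<open>tendsto_char_expansion\<close>.\<close>

lemma char_normal_distribution:
  "char (density lborel (normal_density h 1)) t = exp (- (of_real t)\<^sup>2 / 2 + \<i> * of_real (h * t))"
proof -
  have "char (density lborel (normal_density h 1)) t =
      (CLINT x|std_normal_distribution. iexp (t * h) * iexp (t * x))"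
    unfolding char_def
    by (subst normal_distribution_shift, subst integral_distr) (auto simp: algebra_simps exp_add[symmetric])
  also have "\<dots> = iexp (t * h) * char std_normal_distribution t"
    by (simp add: char_def)
  also have "\<dots> = exp (- (of_real t)\<^sup>2 / 2 + \<i> * of_real (h * t))"
    by (simp add: char_std_normal_distribution exp_of_real[symmetric] exp_add[symmetric] mult_ac add_ac)
  finally show ?thesis .
qed

lemma cdf_normal_distribution:
  "cdf (density lborel (normal_density h 1)) z = std_normal_cdf (z - h)"
proof -
  have "(\<lambda>x. h + x) -` {..z} = {..z - h}" by auto
  then show ?thesis
    unfolding cdf_def std_normal_cdf_def
    by (subst normal_distribution_shift) (simp add: measure_distr)
qed

text \<open>A measure with a Lebesgue density has no atoms. Weak convergence to a normal law
  therefore gives convergence of distribution functions at every point.\<close>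

lemma isCont_cdf_normal:
  assumes "0 < \<sigma>"
  shows "isCont (cdf (density lborel (normal_density \<mu> \<sigma>))) z"
proof -
  interpret real_distribution "density lborel (normal_density \<mu> \<sigma>)"
    using assms by (rule real_distribution_normal)
  have "AE x in lborel. x \<noteq> z"
    by (rule AE_lborel_singleton)
  then have "emeasure (density lborel (normal_density \<mu> \<sigma>)) {z} = 0"
    by (auto simp: emeasure_density nn_integral_0_iff_AE indicator_def)
  then show ?thesis by (simp add: isCont_cdf measure_def)
qed

text \<open>\<open>std_normal_quantile\<close> is an inverse by choice, so it suffices to exhibit
  one preimage of \<open>p\<close>. The limits 0 and 1 at infinity and the intermediate value
  theorem supply it.\<close>

lemma std_normal_cdf_quantile:
  assumes "0 < p" "p < 1"
  shows "std_normal_cdf (std_normal_quantile p) = p"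
proof -
  interpret real_distribution std_normal_distribution by (rule real_dist_normal_dist)
  obtain a where a: "std_normal_cdf a < p"
    using order_tendstoD(2)[OF cdf_lim_at_bot assms(1)] unfolding std_normal_cdf_def
    by (metis eventually_happens' trivial_limit_at_bot_linorder)
  obtain b where b: "p < std_normal_cdf b"
    using order_tendstoD(1)[OF cdf_lim_at_top_prob assms(2)] unfolding std_normal_cdf_def
    by (metis eventually_happens' trivial_limit_at_top_linorder)
  have "a \<le> b"
    using a b cdf_nondecreasing[of b a] by (force simp: std_normal_cdf_def)
  then obtain x where "std_normal_cdf x = p"
    using IVT[of std_normal_cdf a p b] a b isCont_cdf_normal[where \<mu>=0 and \<sigma>=1]
    by (auto simp: std_normal_cdf_def)
  then show ?thesis
    unfolding std_normal_quantile_def by (metis f_inv_into_f rangeI)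
qed

section \<open>Convergence in law under the null and the local alternatives\<close>

context score
begin

text \<open>Levy's continuity theorem, with the characteristic functions treated as
  \<open>m\<close>-th powers. The bounds on \<open>a m\<close> hold for every \<open>m\<close>,
  since each law in the sequence must be a probability; the formula for \<open>a m\<close> matters
  only eventually.\<close>

theorem weak_conv_tilted:
  assumes h: "0 \<le> h" and a: "\<And>m. 0 \<le> a m" "\<And>m. a m \<le> 1"
    and a_eq: "\<forall>\<^sub>F m in sequentially. a m = h / (\<rho> * sqrt (real m))"
  shows "weak_conv_m (\<lambda>m. distr (prod_power (tilted (a m)) m) borel (Z m))
    (density lborel (normal_density h 1))"
proof (rule levy_continuity[OF _ real_distribution_normal[OF zero_less_one]])
  fix m
  show "real_distribution (distr (prod_power (tilted (a m)) m) borel (Z m))"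
    using Z_measurable prob_space.prob_space_prod_power[OF prob_space_tilted[OF a]]
    by (intro prob_space.real_distribution_distr) auto
next
  fix t :: real
  define z where "z m = (CLINT x|tilted (a m). iexp (t / (\<rho> * sqrt m) * g x))" for m
  define c :: complex where "c = - (of_real t)\<^sup>2 / 2 + \<i> * of_real (h * t)"
  have char: "char (distr (prod_power (tilted (a m)) m) borel (Z m)) t = z m ^ m" for m
  proof -
    interpret T: prob_space "tilted (a m)" by (rule prob_space_tilted[OF a])
    show ?thesis
      using T.char_distr_prod_power[of g m "1 / (\<rho> * sqrt m)" t]
      by (simp add: Z_def[abs_def] z_def)
  qed
  have "(\<lambda>m. z m ^ m) \<longlonglongrightarrow> exp c"
  proof (rule tendsto_power_exp)
    fix m
    interpret T: prob_space "tilted (a m)" by (rule prob_space_tilted[OF a])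
    have "norm (z m) \<le> (\<integral>x. norm (iexp (t / (\<rho> * sqrt m) * g x)) \<partial>tilted (a m))"
      unfolding z_def by (rule integral_norm_bound)
    then show "norm (z m) \<le> 1" by (simp add: T.prob_space[unfolded space_tilted])
  next
    show "Re c \<le> 0"
      by (simp add: c_def flip: of_real_power)
    show "(\<lambda>m. of_nat m * (z m - 1)) \<longlonglongrightarrow> c"
      using tendsto_char_expansion[OF h, of t, folded c_def]
    proof (rule Lim_transform_eventually)
      show "\<forall>\<^sub>F m in sequentially. of_nat m * (CLINT x|M.
          (iexp (t / (\<rho> * sqrt m) * g x) - 1 - \<i> * of_real (t / (\<rho> * sqrt m) * g x))
          + of_real (h / (\<rho> * sqrt m) * g x) * (iexp (t / (\<rho> * sqrt m) * g x) - 1))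
        = of_nat m * (z m - 1)"
        using a_eq
      proof eventually_elim
        case (elim m)
        show ?case
          unfolding z_def CLINT_tilted_iexp[OF a] unfolding elim ..
      qed
    qed
  qed
  then show "(\<lambda>m. char (distr (prod_power (tilted (a m)) m) borel (Z m)) t) \<longlonglongrightarrow>
      char (density lborel (normal_density h 1)) t"
    by (simp add: char char_normal_distribution c_def)
qed

text \<open>The null is the alternative with \<open>h = 0\<close> and tilt 0.\<close>

corollary weak_conv_null:
  "weak_conv_m (\<lambda>m. distr (prod_power M m) borel (Z m)) std_normal_distribution"
  using weak_conv_tilted[of 0 "\<lambda>_. 0"] by (simp add: tilted_0)

end

subsection \<open>Expansion of the log-likelihood ratio\<close>

text \<open>
  The cut-off makes \<open>(ln_remainder x)\<^sup>2\<close> at most \<open>x\<^sup>2\<close>, so that Chebyshev's inequality applies although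
  \<open>g\<close> has no fourth moment.
\<close>
definition ln_remainder :: "real \<Rightarrow> real" where
  "ln_remainder x = (if \<bar>x\<bar> \<le> 1/2 then ln (1 + x) - x else 0)"

lemma ln_remainder_measurable [measurable]: "ln_remainder \<in> borel_measurable borel"
  unfolding ln_remainder_def[abs_def] by measurable

lemma abs_ln_remainder_le: "\<bar>ln_remainder x\<bar> \<le> 2 * x\<^sup>2"
  using abs_ln_one_plus_x_minus_x_bound[of x] by (simp add: ln_remainder_def)

text \<open>For \<open>|x| <= 1/2\<close> one has \<open>2 x^2 <= |x|\<close>, which turns the
  quadratic bound on the remainder into a linear one.\<close>

lemma ln_remainder_square_le: "(ln_remainder x)\<^sup>2 \<le> x\<^sup>2"
proof (cases "\<bar>x\<bar> \<le> 1/2")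
  case True
  then have "\<bar>x\<bar> * \<bar>x\<bar> \<le> (1/2) * \<bar>x\<bar>"
    by (intro mult_right_mono) auto
  then have "2 * x\<^sup>2 \<le> \<bar>x\<bar>"
    by (simp add: power2_eq_square)
  with abs_ln_remainder_le[of x] show ?thesis
    by (metis abs_le_square_iff order_trans)
qed (simp add: ln_remainder_def)

lemma eventually_abs_divide_sqrt_le:
  "\<forall>\<^sub>F m in sequentially. \<bar>u / sqrt (real m)\<bar> \<le> 1/2"
proof -
  have "(\<lambda>m. \<bar>u / sqrt (real m)\<bar>) \<longlonglongrightarrow> \<bar>0\<bar>"
    by (intro tendsto_rabs tendsto_divide_sqrt_0)
  then show ?thesis
    by (auto dest!: order_tendstoD(2)[of _ _ _ "1/2"] elim!: eventually_mono)
qed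

text \<open>For fixed \<open>u\<close> the cut-off is eventually inactive, and the limit is that of
  the logarithm's second-order term.\<close>

lemma tendsto_ln_remainder:
  "(\<lambda>m. real m * ln_remainder (u / sqrt (real m))) \<longlonglongrightarrow> - u\<^sup>2 / 2"
proof (rule Lim_transform_eventually)
  show "\<forall>\<^sub>F m in sequentially.
      real m * (ln (1 + u / sqrt m) - u / sqrt m) = real m * ln_remainder (u / sqrt (real m))"
    using eventually_abs_divide_sqrt_le[of u]
    by eventually_elim (simp add: ln_remainder_def)
  \<comment> \<open>The asymptotic expansion is computed with the sign of \<open>u\<close>
    known.\<close>
  consider "u > 0" | "u = 0" | "u < 0" by linarith
  then show "(\<lambda>m. real m * (ln (1 + u / sqrt m) - u / sqrt m)) \<longlonglongrightarrow> - u\<^sup>2 / 2"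
    by cases (real_asymp simp: power2_eq_square, simp, real_asymp simp: power2_eq_square)
qed

text \<open>Serves to pass from the explicit product to the Radon-Nikodym derivative, which is
  determined only up to null sets.\<close>

lemma vanishes_in_prob_cong_AE:
  assumes Y: "\<And>m. Y m \<in> borel_measurable (M m)" and X: "vanishes_in_prob M X"
    and eq: "\<forall>\<^sub>F m in sequentially. AE y in M m. X m y = Y m y"
  shows "vanishes_in_prob M Y"
  unfolding vanishes_in_prob_def
proof (intro conjI allI impI Y)
  fix \<delta> :: real assume "\<delta> > 0"
  then have "(\<lambda>m. measure (M m) {y \<in> space (M m). \<bar>X m y\<bar> > \<delta>}) \<longlonglongrightarrow> 0"
    using X by (simp add: vanishes_in_prob_def)
  then show "(\<lambda>m. measure (M m) {y \<in> space (M m). \<bar>Y m y\<bar> > \<delta>}) \<longlonglongrightarrow> 0"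
  proof (rule Lim_transform_eventually)
    show "\<forall>\<^sub>F m in sequentially. measure (M m) {y \<in> space (M m). \<bar>X m y\<bar> > \<delta>} =
        measure (M m) {y \<in> space (M m). \<bar>Y m y\<bar> > \<delta>}"
      using eq
    proof eventually_elim
      case (elim m)
      have [measurable]: "X m \<in> borel_measurable (M m)" "Y m \<in> borel_measurable (M m)"
        using X Y by (auto simp: vanishes_in_prob_def)
      show ?case
        by (rule measure_eq_AE) (use elim in auto)
    qed
  qed
qed

text \<open>Bounded convergence in probability over varying spaces: where \<open>|X m|\<close>
  exceeds \<open>\<delta>\<close> the integrand is at most \<open>c\<close> on an event of small
  probability, elsewhere it is at most \<open>c \<delta>\<close>.\<close>

lemma integral_tendsto_0_vanishes_in_prob:
  assumes M: "\<And>m. prob_space (M m)" and X: "vanishes_in_prob M X"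
    and F: "\<And>m. F m \<in> borel_measurable (M m)" and c: "0 \<le> c"
    and bound: "\<forall>\<^sub>F m in sequentially. AE y in M m. \<bar>F m y\<bar> \<le> c * min \<bar>X m y\<bar> 1"
  shows "(\<lambda>m. \<integral>y. F m y \<partial>M m) \<longlonglongrightarrow> 0"
proof (rule tendstoI)
  fix e :: real assume e: "e > 0"
  \<comment> \<open>Each of the two parts may cost \<open>e / 2\<close>; the denominator
    \<open>c + 1\<close> also covers \<open>c = 0\<close>.\<close>
  define \<delta> where "\<delta> = e / (2 * (c + 1))"
  have \<delta>: "\<delta> > 0" "c * \<delta> < e / 2" using e c by (auto simp: \<delta>_def field_simps)
  have lim: "(\<lambda>m. measure (M m) {y \<in> space (M m). \<bar>X m y\<bar> > \<delta>}) \<longlonglongrightarrow> 0"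
    using X \<delta> by (simp add: vanishes_in_prob_def)
  have "\<forall>\<^sub>F m in sequentially. measure (M m) {y \<in> space (M m). \<bar>X m y\<bar> > \<delta>} < e / (2 * (c + 1))"
    by (rule order_tendstoD(2)[OF lim]) (use e c in auto)
  with bound show "\<forall>\<^sub>F m in sequentially. dist (\<integral>y. F m y \<partial>M m) 0 < e"
  proof eventually_elim
    case (elim m)
    interpret prob_space "M m" by (rule M)
    have [measurable]: "X m \<in> borel_measurable (M m)" using X by (auto simp: vanishes_in_prob_def)
    note F[measurable]
    let ?B = "{y \<in> space (M m). \<bar>X m y\<bar> > \<delta>}"
    have F_le: "AE y in M m. norm (F m y) \<le> c * \<delta> + c * indicator ?B y"
      using elim(1) AE_space
    proof eventually_elim
      case (elim y)
      show ?case
      proof (cases "y \<in> ?B")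
        case True
        have "c * min \<bar>X m y\<bar> 1 \<le> c * 1" using c by (intro mult_left_mono) auto
        with elim True c \<delta> show ?thesis by (auto intro: order_trans add_increasing)
      next
        case False
        then have "c * min \<bar>X m y\<bar> 1 \<le> c * \<delta>" using elim c by (intro mult_left_mono) auto
        with elim False show ?thesis by auto
      qed
    qed
    have [measurable]: "?B \<in> events" by measurable
    have B_int: "integrable (M m) (indicator ?B :: _ \<Rightarrow> real)"
      by (intro integrable_real_indicator) (auto simp: less_top[symmetric])
    have int: "integrable (M m) (\<lambda>y. c * \<delta> + c * indicator ?B y)"
      using B_int by simp
    moreover have "integrable (M m) (F m)"
      by (rule Bochner_Integration.integrable_bound[OF int])
        (use F_le c \<delta> in \<open>auto elim!: eventually_mono\<close>)
    ultimately have "norm (\<integral>y. F m y \<partial>M m) \<le> (\<integral>y. c * \<delta> + c * indicator ?B y \<partial>M m)"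
      using F_le by (intro order_trans[OF integral_norm_bound] integral_mono_AE integrable_norm)
    also have "\<dots> = c * \<delta> + c * prob ?B"
      using B_int by (simp add: prob_space Bochner_Integration.integral_add)
    also have "c * prob ?B \<le> c * (e / (2 * (c + 1)))"
      using elim(2) c by (intro mult_left_mono) auto
    also have "\<dots> \<le> e / 2" using e c by (simp add: field_simps)
    finally show ?case using \<delta> by simp
  qed
qed

text \<open>Chebyshev's inequality for the centred sum, with the variance of \<open>f\<close>
  bounded by its second moment.\<close>

lemma (in prob_space) sum_deviation_prod_power:
  fixes f :: "'a \<Rightarrow> real"
  assumes [measurable]: "f \<in> borel_measurable M" and f: "integrable M (\<lambda>x. (f x)\<^sup>2)" and e: "e > 0"
  shows "measure (prod_power M m) {y \<in> space (prod_power M m). \<bar>(\<Sum>i<m. f (y i)) - m * expectation f\<bar> \<ge> e}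
    \<le> m * expectation (\<lambda>x. (f x)\<^sup>2) / e\<^sup>2"
proof -
  interpret P: prob_space "prod_power M m" by (rule prob_space_prod_power)
  define f' where "f' x = f x - expectation f" for x
  have f1: "integrable M f"
    by (rule square_integrable_imp_integrable[OF _ f]) simp
  have f': "integrable M f'" "integrable M (\<lambda>x. (f' x)\<^sup>2)" "expectation f' = 0"
    using f f1 by (auto simp: f'_def[abs_def] power2_diff prob_space)
  have var: "expectation (\<lambda>x. (f' x)\<^sup>2) \<le> expectation (\<lambda>x. (f x)\<^sup>2)"
    using variance_eq[OF f1 f] by (simp add: f'_def)
  have sum: "(\<Sum>i<m. f' (y i)) = (\<Sum>i<m. f (y i)) - m * expectation f" for y :: "nat \<Rightarrow> 'a"
    by (simp add: f'_def sum_subtractf)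
  have "P.prob {y \<in> space (prod_power M m). \<bar>\<Sum>i<m. f' (y i)\<bar> \<ge> e} \<le>
      P.expectation (\<lambda>y. (\<Sum>i<m. f' (y i))\<^sup>2) / e\<^sup>2"
    using f' e by (intro P.second_moment_method borel_measurable_sum_prod_power
      integrable_sum_square_prod_power) auto
  also have "\<dots> = m * expectation (\<lambda>x. (f' x)\<^sup>2) / e\<^sup>2"
    by (simp add: integral_sum_square_prod_power f')
  also have "\<dots> \<le> m * expectation (\<lambda>x. (f x)\<^sup>2) / e\<^sup>2"
    using var by (intro divide_right_mono mult_left_mono) auto
  finally show ?thesis by (simp add: sum)
qed

section \<open>Moments of the truncated remainder and the resulting expansion\<close>

context score
begin

text \<open>Three dominated convergences with the factor \<open>m\<close> moved under the integral.
  The inequality \<open>m (u / sqrt m)^2 <= u^2\<close> makes the majorants \<open>2 u^2\<close>,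
  \<open>u^2\<close> and \<open>4 u^2\<close> independent of \<open>m\<close>.\<close>

lemma
  assumes h: "0 \<le> h"
  shows tendsto_mean_ln_remainder:
      "(\<lambda>m. m * expectation (\<lambda>x. ln_remainder (h * g x / \<rho> / sqrt m))) \<longlonglongrightarrow> - h\<^sup>2 / 2"
    and tendsto_square_ln_remainder:
      "(\<lambda>m. m * expectation (\<lambda>x. (ln_remainder (h * g x / \<rho> / sqrt m))\<^sup>2)) \<longlonglongrightarrow> 0"
    and tendsto_prob_large_increment:
      "(\<lambda>m. m * prob {x \<in> space M. \<bar>h * g x / \<rho> / sqrt m\<bar> > 1 / 2}) \<longlonglongrightarrow> 0"
proof -
  define u where "u x = h * g x / \<rho>" for x
  have [measurable]: "u \<in> borel_measurable M"
    by (simp add: u_def[abs_def])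
  have u_sq: "(u x)\<^sup>2 = h\<^sup>2 / \<rho>\<^sup>2 * (g x)\<^sup>2" for x
    by (simp add: u_def power_mult_distrib power_divide)
  have int_u: "integrable M (\<lambda>x. c * (u x)\<^sup>2)" for c
    using g_square_integrable by (simp add: u_sq)
  have exp_u: "expectation (\<lambda>x. c * (u x)\<^sup>2) = c * h\<^sup>2" for c
    using \<rho>_pos by (simp add: u_sq g_second_moment)
  have scale: "real m * (u x / sqrt m)\<^sup>2 \<le> (u x)\<^sup>2" for m x
    by (cases "m = 0") (auto simp: power_divide)

  have "(\<lambda>m. expectation (\<lambda>x. m * ln_remainder (u x / sqrt m))) \<longlonglongrightarrow> expectation (\<lambda>x. - 1 / 2 * (u x)\<^sup>2)"
  proof (rule integral_dominated_convergence[OF _ _ int_u[of 2]])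
    show "AE x in M. (\<lambda>m. m * ln_remainder (u x / sqrt m)) \<longlonglongrightarrow> - 1 / 2 * (u x)\<^sup>2"
      using tendsto_ln_remainder by simp
    show "AE x in M. norm (m * ln_remainder (u x / sqrt m)) \<le> 2 * (u x)\<^sup>2" for m :: nat
    proof (rule AE_I2)
      fix x
      have "norm (m * ln_remainder (u x / sqrt m)) \<le> m * (2 * (u x / sqrt m)\<^sup>2)"
        using abs_ln_remainder_le by (auto simp: abs_mult intro!: mult_left_mono)
      also have "\<dots> \<le> 2 * (u x)\<^sup>2" using scale[of m x] by simp
      finally show "norm (m * ln_remainder (u x / sqrt m)) \<le> 2 * (u x)\<^sup>2" .
    qed
  qed auto
  then show "(\<lambda>m. m * expectation (\<lambda>x. ln_remainder (h * g x / \<rho> / sqrt m))) \<longlonglongrightarrow> - h\<^sup>2 / 2"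
    unfolding exp_u by (simp add: u_def)

  have "(\<lambda>m. expectation (\<lambda>x. m * (ln_remainder (u x / sqrt m))\<^sup>2)) \<longlonglongrightarrow> expectation (\<lambda>x. 0)"
  proof (rule integral_dominated_convergence[OF _ _ int_u[of 1]])
    \<comment> \<open>The quantity is the square of the convergent sequence
      \<open>m * ln_remainder\<close> divided by \<open>m\<close>.\<close>
    have "(\<lambda>m. (m * ln_remainder (u x / sqrt m)) * (m * ln_remainder (u x / sqrt m)) * (1 / real m))
        \<longlonglongrightarrow> (- (u x)\<^sup>2 / 2) * (- (u x)\<^sup>2 / 2) * 0" for x
      by (intro tendsto_mult tendsto_ln_remainder lim_1_over_n)
    moreover have "(m * ln_remainder (u x / sqrt m)) * (m * ln_remainder (u x / sqrt m)) * (1 / real m) =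
        m * (ln_remainder (u x / sqrt m))\<^sup>2" for m x
      by (cases "m = 0") (simp_all add: power2_eq_square)
    ultimately show "AE x in M. (\<lambda>m. m * (ln_remainder (u x / sqrt m))\<^sup>2) \<longlonglongrightarrow> 0"
      by simp
    show "AE x in M. norm (m * (ln_remainder (u x / sqrt m))\<^sup>2) \<le> 1 * (u x)\<^sup>2" for m :: nat
    proof (rule AE_I2)
      fix x
      have "norm (m * (ln_remainder (u x / sqrt m))\<^sup>2) \<le> m * (u x / sqrt m)\<^sup>2"
        using ln_remainder_square_le by (auto simp: abs_mult intro!: mult_left_mono)
      also have "\<dots> \<le> 1 * (u x)\<^sup>2" using scale[of m x] by simp
      finally show "norm (m * (ln_remainder (u x / sqrt m))\<^sup>2) \<le> 1 * (u x)\<^sup>2" .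
    qed
  qed auto
  then show "(\<lambda>m. m * expectation (\<lambda>x. (ln_remainder (h * g x / \<rho> / sqrt m))\<^sup>2)) \<longlonglongrightarrow> 0"
    by (simp add: u_def)

  define B where "B m = {x \<in> space M. \<bar>u x / sqrt m\<bar> > 1 / 2}" for m :: nat
  have [measurable]: "B m \<in> sets M" for m by (simp add: B_def)
  have "(\<lambda>m. expectation (\<lambda>x. real m * indicator (B m) x)) \<longlonglongrightarrow> expectation (\<lambda>x. 0)"
  proof (rule integral_dominated_convergence[OF _ _ int_u[of 4]])
    show "AE x in M. (\<lambda>m. real m * indicator (B m) x) \<longlonglongrightarrow> (0 :: real)"
    proof (intro AE_I2 tendsto_eventually)
      fix x
      show "\<forall>\<^sub>F m in sequentially. real m * indicator (B m) x = (0 :: real)"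
        using eventually_abs_divide_sqrt_le[of "u x"]
        by eventually_elim (simp add: B_def)
    qed
    show "AE x in M. norm (real m * indicator (B m) x) \<le> 4 * (u x)\<^sup>2" for m :: nat
    proof (rule AE_I2)
      fix x
      \<comment> \<open>Markov-type bound: on \<open>B m\<close> the increment exceeds 1/2, so four
        times its square exceeds 1.\<close>
      have "indicator (B m) x \<le> 4 * (u x / sqrt m)\<^sup>2"
      proof (cases "x \<in> B m")
        case True
        then have "(1 / 2)\<^sup>2 \<le> \<bar>u x / sqrt m\<bar>\<^sup>2"
          by (intro power_mono) (auto simp: B_def)
        then show ?thesis using True unfolding power2_abs by (simp add: power2_eq_square mult_ac)
      qed simp
      then have "norm (real m * indicator (B m) x) \<le> m * (4 * (u x / sqrt m)\<^sup>2)"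
        by (auto simp: abs_mult intro!: mult_left_mono)
      also have "\<dots> \<le> 4 * (u x)\<^sup>2" using scale[of m x] by simp
      finally show "norm (real m * indicator (B m) x) \<le> 4 * (u x)\<^sup>2" .
    qed
  qed auto
  then show "(\<lambda>m. m * prob {x \<in> space M. \<bar>h * g x / \<rho> / sqrt m\<bar> > 1 / 2}) \<longlonglongrightarrow> 0"
    by (simp add: B_def u_def)
qed

text \<open>Unless some increment exceeds 1/2, the logarithm of the product is \<open>h Z m\<close>
  plus a sum of truncated remainders, which concentrates at its mean, close to
  \<open>- h^2 / 2\<close>. The explicit product may be nonpositive for some \<open>y\<close>, but
  only inside the exceptional event.\<close>

lemma log_likelihood_expansion:
  assumes h: "0 \<le> h"
  shows "vanishes_in_prob (prod_power M)
    (\<lambda>m y. ln (\<Prod>i<m. 1 + h / (\<rho> * sqrt m) * g (y i)) - (h * Z m y - h\<^sup>2 / 2))"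
    (is "vanishes_in_prob _ ?X")
  unfolding vanishes_in_prob_def
proof (intro conjI allI impI)
  show "?X m \<in> borel_measurable (prod_power M m)" for m
    using borel_measurable_prod_prod_power[of "\<lambda>x. 1 + h / (\<rho> * sqrt m) * g x" M m] Z_measurable[of m]
    by measurable
next
  fix \<delta> :: real assume \<delta>: "\<delta> > 0"
  define v where "v m x = h * g x / \<rho> / sqrt (real m)" for m x
  have [measurable]: "v m \<in> borel_measurable M" for m by (simp add: v_def[abs_def])
  define \<mu> where "\<mu> m = m * expectation (\<lambda>x. ln_remainder (v m x))" for m :: nat
  define \<sigma> where "\<sigma> m = m * expectation (\<lambda>x. (ln_remainder (v m x))\<^sup>2)" for m :: nat
  define \<beta> where "\<beta> m = m * prob {x \<in> space M. \<bar>v m x\<bar> > 1 / 2}" for m :: nat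
  have \<mu>: "\<mu> \<longlonglongrightarrow> - h\<^sup>2 / 2" and \<sigma>: "\<sigma> \<longlonglongrightarrow> 0" and \<beta>: "\<beta> \<longlonglongrightarrow> 0"
    using tendsto_mean_ln_remainder[OF h] tendsto_square_ln_remainder[OF h]
      tendsto_prob_large_increment[OF h]
    by (simp_all add: \<mu>_def[abs_def] \<sigma>_def[abs_def] \<beta>_def[abs_def] v_def)
  have \<mu>': "\<forall>\<^sub>F m in sequentially. \<bar>\<mu> m + h\<^sup>2 / 2\<bar> < \<delta> / 2"
    using tendstoD[OF \<mu>, of "\<delta> / 2"] \<delta> by (simp add: dist_real_def)
  show "(\<lambda>m. measure (prod_power M m) {y \<in> space (prod_power M m). \<bar>?X m y\<bar> > \<delta>}) \<longlonglongrightarrow> 0"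
  proof (rule Lim_null_comparison)
    show "(\<lambda>m. \<beta> m + \<sigma> m / (\<delta> / 2)\<^sup>2) \<longlonglongrightarrow> 0"
      using tendsto_add[OF \<beta> tendsto_divide[OF \<sigma> tendsto_const[of "(\<delta> / 2)\<^sup>2"]]] \<delta> by simp
    show "\<forall>\<^sub>F m in sequentially. norm (measure (prod_power M m) {y \<in> space (prod_power M m). \<bar>?X m y\<bar> > \<delta>})
        \<le> \<beta> m + \<sigma> m / (\<delta> / 2)\<^sup>2"
      using \<mu>'
    proof eventually_elim
      case (elim m)
      interpret P: prob_space "prod_power M m" by (rule prob_space_prod_power)
      let ?\<Omega> = "space (prod_power M m)"
      \<comment> \<open>\<open>L i\<close> is the event of a large increment at coordinate
        \<open>i\<close>, and \<open>C\<close> that of a large deviation of the remainders. Half of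
        \<open>\<delta>\<close> is allotted to the deviation in \<open>C\<close>, the other half to
        the bias \<open>\<mu> m + h^2 / 2\<close>.\<close>
      define L where "L i = {y \<in> ?\<Omega>. \<bar>v m (y i)\<bar> > 1 / 2}" for i
      define C where "C = {y \<in> ?\<Omega>. \<bar>(\<Sum>i<m. ln_remainder (v m (y i))) - \<mu> m\<bar> \<ge> \<delta> / 2}"
      have L_sets [measurable]: "L i \<in> P.events" if "i < m" for i
        using measurable_prod_power_component[OF that, of "v m" M borel] by (simp add: L_def)
      have C_sets [measurable]: "C \<in> P.events"
        using borel_measurable_sum_prod_power[of "\<lambda>x. ln_remainder (v m x)" M m] by (simp add: C_def)
      have "{y \<in> ?\<Omega>. \<bar>?X m y\<bar> > \<delta>} \<subseteq> (\<Union>i<m. L i) \<union> C"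
      proof (rule subsetI, rule ccontr)
        fix y assume y: "y \<in> {y \<in> ?\<Omega>. \<bar>?X m y\<bar> > \<delta>}" and "y \<notin> (\<Union>i<m. L i) \<union> C"
        then have small: "\<bar>v m (y i)\<bar> \<le> 1 / 2" if "i < m" for i
          using that by (force simp: L_def)
        have "ln (\<Prod>i<m. 1 + h / (\<rho> * sqrt m) * g (y i)) = ln (\<Prod>i<m. 1 + v m (y i))"
          by (simp add: v_def)
        also have "\<dots> = (\<Sum>i<m. ln (1 + v m (y i)))"
          \<comment> \<open>Off the events \<open>L i\<close> every factor is at least 1/2, so the
            logarithm of the product splits.\<close>
          using small by (intro ln_prod) (fastforce simp: abs_le_iff)+
        also have "\<dots> = (\<Sum>i<m. ln_remainder (v m (y i)) + v m (y i))"
          using small by (intro sum.cong) (auto simp: ln_remainder_def)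
        also have "\<dots> = (\<Sum>i<m. ln_remainder (v m (y i))) + h * Z m y"
          by (simp add: sum.distrib Z_def v_def sum_distrib_left)
        finally have X: "?X m y = ((\<Sum>i<m. ln_remainder (v m (y i))) - \<mu> m) + (\<mu> m + h\<^sup>2 / 2)"
          by simp
        have "\<bar>(\<Sum>i<m. ln_remainder (v m (y i))) - \<mu> m\<bar> < \<delta> / 2"
          using y \<open>y \<notin> (\<Union>i<m. L i) \<union> C\<close> by (auto simp: C_def)
        then have "\<bar>?X m y\<bar> < \<delta>"
          unfolding X using elim by linarith
        with y show False by simp
      qed
      then have "P.prob {y \<in> ?\<Omega>. \<bar>?X m y\<bar> > \<delta>} \<le> P.prob ((\<Union>i<m. L i) \<union> C)"
        by (intro P.finite_measure_mono sets.Un sets.finite_UN) auto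
      also have "\<dots> \<le> P.prob (\<Union>i<m. L i) + P.prob C"
        by (intro measure_Un_le sets.finite_UN) auto
      finally have union: "P.prob {y \<in> ?\<Omega>. \<bar>?X m y\<bar> > \<delta>} \<le> P.prob (\<Union>i<m. L i) + P.prob C" .
      have "P.prob (\<Union>i<m. L i) \<le> (\<Sum>i<m. P.prob (L i))"
        by (intro measure_UNION_le) auto
      also have "\<dots> = (\<Sum>i<m. prob {x \<in> space M. \<bar>v m x\<bar> > 1 / 2})"
      proof (intro sum.cong refl)
        fix i assume "i \<in> {..<m}"
        then have i: "i < m" by simp
        have coord: "(\<lambda>y. y i) \<in> measurable (prod_power M m) M"
          using measurable_prod_power_component[OF i, of "\<lambda>x. x" M M] by simp
        then have L_vimage: "L i = (\<lambda>y. y i) -` {x \<in> space M. \<bar>v m x\<bar> > 1 / 2} \<inter> ?\<Omega>"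
          by (auto simp: L_def dest: measurable_space)
        have "P.prob (L i) =
            measure (distr (prod_power M m) M (\<lambda>y. y i)) {x \<in> space M. \<bar>v m x\<bar> > 1 / 2}"
          unfolding L_vimage by (rule measure_distr[OF coord, symmetric]) measurable
        then show "P.prob (L i) = prob {x \<in> space M. \<bar>v m x\<bar> > 1 / 2}"
          by (simp add: distr_prod_power_component[OF i])
      qed
      also have "\<dots> = \<beta> m" by (simp add: \<beta>_def)
      finally have L_le: "P.prob (\<Union>i<m. L i) \<le> \<beta> m" .
      have "P.prob C \<le> \<sigma> m / (\<delta> / 2)\<^sup>2"
        unfolding C_def \<sigma>_def \<mu>_def
      proof (rule sum_deviation_prod_power)
        show "integrable M (\<lambda>x. (ln_remainder (v m x))\<^sup>2)"
        proof (rule Bochner_Integration.integrable_bound)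
          show "integrable M (\<lambda>x. (v m x)\<^sup>2)"
            using g_square_integrable by (simp add: v_def power_divide power_mult_distrib)
        qed (use ln_remainder_square_le in auto)
      qed (use \<delta> in auto)
      with union L_le show ?case by simp
    qed
  qed
qed

end

subsection \<open>The Neyman--Pearson bound\<close>

text \<open>The level constraint holds only in the limit superior. A slack \<open>\<delta>\<close>
  is divided into \<open>\<delta> / (2 k)\<close> for \<open>e\<close>, which the factor
  \<open>k\<close> turns into \<open>\<delta> / 2\<close>, and \<open>\<delta> / 2\<close> for
  \<open>c\<close>.\<close>

lemma limsup_affine_le:
  fixes f e c :: "nat \<Rightarrow> real"
  assumes le: "\<forall>\<^sub>F m in sequentially. f m \<le> k * e m + c m" and k: "0 < k"
    and e: "limsup (\<lambda>m. ereal (e m)) \<le> ereal \<tau>" and c: "c \<longlonglongrightarrow> C"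
  shows "limsup (\<lambda>m. ereal (f m)) \<le> ereal (k * \<tau> + C)"
proof (rule ereal_le_epsilon2)
  fix \<delta> :: real assume \<delta>: "0 < \<delta>"
  have "ereal \<tau> < ereal (\<tau> + \<delta> / (2 * k))" using \<delta> k by simp
  with e have "limsup (\<lambda>m. ereal (e m)) < ereal (\<tau> + \<delta> / (2 * k))" by (rule le_less_trans)
  from Limsup_lessD[OF this] have "\<forall>\<^sub>F m in sequentially. e m < \<tau> + \<delta> / (2 * k)" by simp
  moreover have "\<forall>\<^sub>F m in sequentially. c m < C + \<delta> / 2"
    using \<delta> by (intro order_tendstoD(2)[OF c]) simp
  ultimately have "\<forall>\<^sub>F m in sequentially. ereal (f m) \<le> ereal (k * \<tau> + C) + ereal \<delta>"
    using le
  proof eventually_elim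
    case (elim m)
    have "k * e m \<le> k * (\<tau> + \<delta> / (2 * k))" using elim k by (intro mult_left_mono) auto
    also have "\<dots> = k * \<tau> + \<delta> / 2" using k by (simp add: field_simps)
    finally show ?case using elim by simp
  qed
  then show "limsup (\<lambda>m. ereal (f m)) \<le> ereal (k * \<tau> + C) + ereal \<delta>"
    by (rule Limsup_bounded)
qed

text \<open>Where \<open>exp v <= k\<close> the slope of \<open>k - exp v\<close> is at most
  \<open>k\<close> in modulus, and beyond that point the positive part is constant. The bound by
  \<open>k\<close> alone holds because all values lie between 0 and \<open>k\<close>.\<close>

lemma pos_part_diff_exp_lipschitz:
  fixes k v w :: real
  assumes k: "0 < k"
  shows "\<bar>max 0 (k - exp v) - max 0 (k - exp w)\<bar> \<le> k * min \<bar>v - w\<bar> 1"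
proof -
  have *: "\<bar>max 0 (k - exp v) - max 0 (k - exp w)\<bar> \<le> k * \<bar>v - w\<bar>" if "v \<le> w" for v w :: real
  proof (cases "exp v \<le> k")
    case True
    \<comment> \<open>The function vanishes from \<open>ln k\<close> on, so cutting \<open>w\<close>
      back to \<open>ln k\<close> leaves its value unchanged.\<close>
    define w' where "w' = min w (ln k)"
    have vw': "v \<le> w'" using that True k by (simp add: w'_def ln_ge_iff)
    have w'k: "exp w' \<le> k" using k by (simp add: w'_def min_def) (metis exp_ln exp_le_cancel_iff linear)
    have mx: "max 0 (k - exp w) = k - exp w'"
      using k by (simp add: w'_def min_def max_def) (metis exp_ln exp_le_cancel_iff order_antisym linear)
    \<comment> \<open>Convexity: \<open>exp\<close> lies above its tangent at
      \<open>w'\<close>.\<close>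
    have "1 + (v - w') \<le> exp (v - w')" by (rule exp_ge_add_one_self)
    then have "exp w' * (1 + (v - w')) \<le> exp w' * exp (v - w')" by simp
    also have "\<dots> = exp v" by (simp flip: exp_add)
    finally have "exp w' - exp v \<le> exp w' * (w' - v)" by (simp add: algebra_simps)
    also have "\<dots> \<le> k * (w' - v)" using w'k vw' by (intro mult_right_mono) auto
    also have "\<dots> \<le> k * (w - v)" using k by (intro mult_left_mono) (auto simp: w'_def)
    finally have "exp w' - exp v \<le> k * (w - v)" .
    with mx True vw' that show ?thesis by simp
  next
    case False
    moreover from this have "k \<le> exp w" using that by (meson exp_le_cancel_iff linear order_trans)
    ultimately show ?thesis using k that by simp
  qed
  have "\<bar>max 0 (k - exp v) - max 0 (k - exp w)\<bar> \<le> k * \<bar>v - w\<bar>"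
    using *[of v w] *[of w v] by (cases "v \<le> w") (simp_all add: abs_minus_commute)
  moreover have "\<bar>max 0 (k - exp v) - max 0 (k - exp w)\<bar> \<le> k"
    using k exp_gt_zero[of v] exp_gt_zero[of w] unfolding max_def abs_le_iff
    by (simp del: exp_gt_zero split: if_split)
  ultimately show ?thesis by (simp add: min_def)
qed

text \<open>The factor \<open>exp (h x - h\<^sup>2 / 2)\<close> is the density of \<open>N(h, 1)\<close> relative to \<open>N(0, 1)\<close>.\<close>
lemma integral_pos_part_normal:
  fixes h z :: real
  assumes h: "0 \<le> h"
  defines "k \<equiv> exp (h * z - h\<^sup>2 / 2)"
  shows "(\<integral>x. max 0 (k - exp (h * x - h\<^sup>2 / 2)) \<partial>std_normal_distribution) =
    k * std_normal_cdf z - std_normal_cdf (z - h)"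
proof -
  have density: "std_normal_density x * exp (h * x - h\<^sup>2 / 2) = normal_density h 1 x" for x
    by (simp add: normal_density_def flip: exp_add) (simp add: power2_eq_square algebra_simps add_divide_distrib diff_divide_distrib)
  \<comment> \<open>The constant \<open>k\<close> is chosen so that the monotone difference vanishes
    at \<open>x = z\<close>; taking the positive part amounts to cutting at
    \<open>z\<close>.\<close>
  have pos: "max 0 (k - exp (h * x - h\<^sup>2 / 2)) = indicator {..z} x * (k - exp (h * x - h\<^sup>2 / 2))" for x
  proof (cases "x \<le> z")
    case True
    then have "h * x \<le> h * z" using h by (rule mult_left_mono)
    with True show ?thesis by (simp add: k_def)
  next
    case False
    then have "h * z \<le> h * x" using h by (intro mult_left_mono) auto
    with False show ?thesis by (simp add: k_def)
  qed
  have cdf: "(\<integral>x. normal_density \<mu> 1 x * indicator {..z} x \<partial>lborel) = std_normal_cdf (z - \<mu>)" for \<mu>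
  proof -
    have "(\<integral>x. normal_density \<mu> 1 x * indicator {..z} x \<partial>lborel) =
        (\<integral>x. indicator {..z} x \<partial>density lborel (normal_density \<mu> 1))"
      by (subst integral_density) auto
    also have "\<dots> = cdf (density lborel (normal_density \<mu> 1)) z"
      by (simp add: cdf_def)
    finally show ?thesis by (simp only: cdf_normal_distribution)
  qed
  have int: "integrable lborel (\<lambda>x. normal_density \<mu> 1 x * indicator {..z} x)" for \<mu>
    by (intro integrable_real_mult_indicator) auto
  have "(\<integral>x. max 0 (k - exp (h * x - h\<^sup>2 / 2)) \<partial>std_normal_distribution) =
      (\<integral>x. std_normal_density x * max 0 (k - exp (h * x - h\<^sup>2 / 2)) \<partial>lborel)"
    by (subst integral_density) auto
  also have "\<dots> = (\<integral>x. k * (normal_density 0 1 x * indicator {..z} x) -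
      normal_density h 1 x * indicator {..z} x \<partial>lborel)"
    unfolding pos density[symmetric] by (intro Bochner_Integration.integral_cong) (auto simp: algebra_simps)
  also have "\<dots> = k * std_normal_cdf (z - 0) - std_normal_cdf (z - h)"
    using int by (simp only: Bochner_Integration.integral_diff integral_mult_right_zero cdf
      integrable_mult_right)
  finally show ?thesis by simp
qed

section \<open>Likelihood ratio of the tilted product\<close>

context score
begin

text \<open>For \<open>a\<close> in [0,1] a version of the density of the tilted product relative to
  the null, fixed as a real function and so free of the ambiguity of \<open>RN_deriv\<close> on null
  sets.\<close>

definition lik :: "real \<Rightarrow> nat \<Rightarrow> (nat \<Rightarrow> 'a) \<Rightarrow> real" where
  "lik a m y = (\<Prod>i<m. 1 + a * g (y i))"

lemma lik_measurable [measurable]: "lik a m \<in> borel_measurable (prod_power M m)"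
  unfolding lik_def[abs_def] by (intro borel_measurable_prod_prod_power) measurable

lemma AE_prod_power_g_ge: "AE y in prod_power M m. \<forall>i<m. - 1 \<le> g (y i)"
proof -
  have "AE y in prod_power M m. \<forall>i\<in>{..<m}. - 1 \<le> g (y i)"
    by (subst AE_ball_countable) (auto intro!: AE_prod_power_component g_ge)
  then show ?thesis by (simp add: Ball_def)
qed

text \<open>Each factor is at least \<open>1 - a\<close>, so strictness of \<open>a < 1\<close>
  ensures that the logarithm is taken of a positive number.\<close>

lemma AE_lik_pos:
  assumes "0 \<le> a" "a < 1"
  shows "AE y in prod_power M m. 0 < lik a m y"
  using AE_prod_power_g_ge
proof eventually_elim
  case (elim y)
  have "0 < 1 + a * g (y i)" if "i < m" for i
  proof -
    have "a * (- 1) \<le> a * g (y i)" using elim that assms by (intro mult_left_mono) auto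
    with assms show ?thesis by simp
  qed
  then show ?case by (auto simp: lik_def intro!: prod_pos)
qed

lemma prod_power_tilted:
  assumes a: "0 \<le> a" "a \<le> 1"
  shows "prod_power (tilted a) m = density (prod_power M m) (\<lambda>y. ennreal (lik a m y))"
proof -
  have "prod_power (tilted a) m = density (prod_power M m) (\<lambda>y. \<Prod>i<m. ennreal (1 + a * g (y i)))"
    using prob_space_tilted[OF a] unfolding tilted_def by (intro prod_power_density) auto
  also have "\<dots> = density (prod_power M m) (\<lambda>y. ennreal (lik a m y))"
  proof (rule density_cong)
    show "(\<lambda>y. \<Prod>i<m. ennreal (1 + a * g (y i))) \<in> borel_measurable (prod_power M m)"
      by (intro borel_measurable_prod_ennreal measurable_prod_power_component) auto
    show "AE y in prod_power M m. (\<Prod>i<m. ennreal (1 + a * g (y i))) = ennreal (lik a m y)"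
      using AE_prod_power_g_ge
    proof eventually_elim
      case (elim y)
      have "0 \<le> 1 + a * g (y i)" if "i < m" for i
      proof -
        have "a * (- 1) \<le> a * g (y i)" using elim that a by (intro mult_left_mono) auto
        with a show ?thesis by simp
      qed
      then show ?case unfolding lik_def by (intro prod_ennreal) simp
    qed
  qed measurable
  finally show ?thesis .
qed

text \<open>Densities relative to a sigma-finite measure are unique almost everywhere; nonnegativity
  of \<open>lik\<close> undoes the coercion to \<open>ennreal\<close>.\<close>

lemma RN_deriv_tilted:
  assumes a: "0 \<le> a" "a < 1"
  shows "AE y in prod_power M m.
    enn2real (RN_deriv (prod_power M m) (prod_power (tilted a) m) y) = lik a m y"
proof -
  interpret T: prob_space "prod_power (tilted a) m"
    using a by (intro prob_space.prob_space_prod_power prob_space_tilted) auto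
  have "AE y in prod_power M m. ennreal (lik a m y) =
      RN_deriv (prod_power M m) (prod_power (tilted a) m) y"
    using a by (intro RN_deriv_unique_sigma_finite T.sigma_finite_measure_axioms)
      (auto simp: prod_power_tilted)
  with AE_lik_pos[OF a, of m] show ?thesis
    by eventually_elim (metis enn2real_ennreal less_imp_le)
qed

lemma
  shows integrable_lik: "integrable (prod_power M m) (lik a m)"
    and integral_lik: "(\<integral>y. lik a m y \<partial>prod_power M m) = 1"
  using integrable_prod_prod_power[of m "\<lambda>_ x. 1 + a * g x"]
    integral_prod_prod_power[of m "\<lambda>_ x. 1 + a * g x"] g_integrable
  by (simp_all add: lik_def[abs_def] prob_space g_mean)

text \<open>As \<open>\<psi>\<close> lies in [0,1], \<open>(L - k) \<psi>\<close> is at most the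
  positive part of \<open>L - k\<close>. Rewriting that part as \<open>L - k\<close> plus the
  positive part of \<open>k - L\<close> leaves a bounded function, accessible to weak convergence
  under the null, since \<open>L\<close> has mean 1.\<close>

lemma Neyman_Pearson_bound:
  assumes a: "0 \<le> a" "a < 1" and k: "0 \<le> k"
    and \<psi> [measurable]: "\<psi> \<in> borel_measurable (prod_power M m)"
    and \<psi>_bounds: "\<And>y. y \<in> space (prod_power M m) \<Longrightarrow> 0 \<le> \<psi> y \<and> \<psi> y \<le> 1"
  shows "(\<integral>y. \<psi> y \<partial>prod_power (tilted a) m) \<le>
    k * (\<integral>y. \<psi> y \<partial>prod_power M m) + (1 - k + (\<integral>y. max 0 (k - lik a m y) \<partial>prod_power M m))"
proof -
  interpret P: prob_space "prod_power M m" by (rule prob_space_prod_power)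
  have pos: "AE y in prod_power M m. 0 < lik a m y" by (rule AE_lik_pos[OF a])
  have \<psi>_int: "integrable (prod_power M m) \<psi>"
    by (rule P.integrable_const_bound[where B=1]) (use \<psi>_bounds in auto)
  have lik_\<psi>_int: "integrable (prod_power M m) (\<lambda>y. lik a m y * \<psi> y)"
  proof (rule Bochner_Integration.integrable_bound[OF integrable_lik[of m a]])
    show "AE y in prod_power M m. norm (lik a m y * \<psi> y) \<le> norm (lik a m y)"
      by (rule AE_I2) (use \<psi>_bounds in \<open>auto simp: abs_mult intro!: mult_left_le\<close>)
  qed measurable
  have max_int: "integrable (prod_power M m) (\<lambda>y. max 0 (k - lik a m y))"
  proof (rule P.integrable_const_bound[where B=k])
    show "AE y in prod_power M m. norm (max 0 (k - lik a m y)) \<le> k"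
      using pos by eventually_elim (use k in auto)
  qed measurable
  have "(\<integral>y. \<psi> y \<partial>prod_power (tilted a) m) = (\<integral>y. lik a m y * \<psi> y \<partial>prod_power M m)"
    using a pos
    by (subst prod_power_tilted, simp, simp, subst integral_density) (auto elim: eventually_mono)
  also have "\<dots> \<le> (\<integral>y. k * \<psi> y + (lik a m y - k + max 0 (k - lik a m y)) \<partial>prod_power M m)"
  proof (rule integral_mono)
    fix y assume "y \<in> space (prod_power M m)"
    note b = \<psi>_bounds[OF this]
    show "lik a m y * \<psi> y \<le> k * \<psi> y + (lik a m y - k + max 0 (k - lik a m y))"
    proof (cases "k \<le> lik a m y")
      case True
      then have "(lik a m y - k) * \<psi> y \<le> (lik a m y - k) * 1" using b by (intro mult_left_mono) auto
      with True show ?thesis by (simp add: algebra_simps)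
    next
      case False
      then have "(lik a m y - k) * \<psi> y \<le> 0" using b by (intro mult_nonpos_nonneg) auto
      with False show ?thesis by (simp add: algebra_simps)
    qed
  qed (use \<psi>_int lik_\<psi>_int max_int integrable_lik in auto)
  also have "\<dots> = k * (\<integral>y. \<psi> y \<partial>prod_power M m) +
      (1 - k + (\<integral>y. max 0 (k - lik a m y) \<partial>prod_power M m))"
    using \<psi>_int max_int integrable_lik[of m a] by (simp add: integral_lik P.prob_space)
  finally show ?thesis .
qed

lemma eventually_scale_less_half: "\<forall>\<^sub>F m in sequentially. h / (\<rho> * sqrt (real m)) \<le> 1 / 2"
  using eventually_abs_divide_sqrt_le[of "h / \<rho>"] unfolding divide_divide_eq_left
  by eventually_elim (rule order_trans[OF abs_ge_self])

text \<open>With \<open>h Z m - h^2 / 2\<close> in place of the log-likelihood the limit is weak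
  convergence tested on the bounded continuous \<open>F\<close>. The Lipschitz bound and the
  expansion in probability make the replacement negligible.\<close>

lemma tendsto_integral_pos_part_lik:
  fixes h z :: real
  assumes h: "0 \<le> h"
  defines "k \<equiv> exp (h * z - h\<^sup>2 / 2)"
  shows "(\<lambda>m. \<integral>y. max 0 (k - lik (h / (\<rho> * sqrt m)) m y) \<partial>prod_power M m)
    \<longlonglongrightarrow> k * std_normal_cdf z - std_normal_cdf (z - h)"
proof -
  define F where "F x = max 0 (k - exp (h * x - h\<^sup>2 / 2))" for x
  define b where "b m = h / (\<rho> * sqrt (real m))" for m
  have k: "0 < k" by (simp add: k_def)
  have b0: "0 \<le> b m" for m using h \<rho>_pos by (simp add: b_def)
  have F_cont: "isCont F x" for x unfolding F_def[abs_def] by (intro continuous_intros)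
  have F_bound: "norm (F x) \<le> k" for x using k by (simp add: F_def)
  have F_meas [measurable]: "F \<in> borel_measurable borel" unfolding F_def[abs_def] by measurable
  note Z_measurable[measurable]
  have "(\<lambda>m. \<integral>x. F x \<partial>distr (prod_power M m) borel (Z m)) \<longlonglongrightarrow> (\<integral>x. F x \<partial>std_normal_distribution)"
  proof (rule weak_conv_imp_integral_bdd_continuous_conv[OF _ _ weak_conv_null F_cont F_bound])
    show "real_distribution (distr (prod_power M m) borel (Z m))" for m
      by (intro prob_space.real_distribution_distr prob_space_prod_power Z_measurable)
  qed (rule real_dist_normal_dist)
  then have lim: "(\<lambda>m. \<integral>y. F (Z m y) \<partial>prod_power M m) \<longlonglongrightarrow> k * std_normal_cdf z - std_normal_cdf (z - h)"
    unfolding F_def k_def integral_pos_part_normal[OF h] by (simp add: integral_distr)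
  have diff: "(\<lambda>m. \<integral>y. max 0 (k - lik (b m) m y) - F (Z m y) \<partial>prod_power M m) \<longlonglongrightarrow> 0"
  proof (rule integral_tendsto_0_vanishes_in_prob[OF prob_space_prod_power log_likelihood_expansion[OF h] _
        less_imp_le[OF k]])
    show "\<forall>\<^sub>F m in sequentially. AE y in prod_power M m.
      \<bar>max 0 (k - lik (b m) m y) - F (Z m y)\<bar> \<le>
        k * min \<bar>ln (\<Prod>i<m. 1 + h / (\<rho> * sqrt m) * g (y i)) - (h * Z m y - h\<^sup>2 / 2)\<bar> 1"
      using eventually_scale_less_half[of h]
    proof eventually_elim
      case (elim m)
      \<comment> \<open>Positivity permits writing \<open>lik\<close> as the exponential of its
        logarithm.\<close>
      have "AE y in prod_power M m. 0 < lik (b m) m y"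
        using elim by (intro AE_lik_pos b0) (linarith | simp only: b_def)+
      then show ?case
      proof eventually_elim
        case (elim y)
        show ?case
          using pos_part_diff_exp_lipschitz[OF k, of "ln (lik (b m) m y)" "h * Z m y - h\<^sup>2 / 2"] elim
          by (simp add: F_def lik_def b_def)
      qed
    qed
  qed measurable
  \<comment> \<open>The integral of the difference splits once both terms are integrable; the bound
    \<open>b m <= 1/2\<close> makes \<open>lik\<close> almost surely positive and the first term
    bounded by \<open>k\<close>.\<close>
  have "\<forall>\<^sub>F m in sequentially.
      (\<integral>y. max 0 (k - lik (b m) m y) - F (Z m y) \<partial>prod_power M m) + (\<integral>y. F (Z m y) \<partial>prod_power M m) =
      (\<integral>y. max 0 (k - lik (b m) m y) \<partial>prod_power M m)"
    using eventually_scale_less_half[of h]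
  proof eventually_elim
    case (elim m)
    interpret P: prob_space "prod_power M m" by (rule prob_space_prod_power)
    have "AE y in prod_power M m. 0 < lik (b m) m y"
      using elim by (intro AE_lik_pos b0) (linarith | simp only: b_def)+
    then have "AE y in prod_power M m. norm (max 0 (k - lik (b m) m y)) \<le> k"
      by eventually_elim (use k in auto)
    then have "integrable (prod_power M m) (\<lambda>y. max 0 (k - lik (b m) m y))"
      by (rule P.integrable_const_bound) measurable
    moreover have "integrable (prod_power M m) (\<lambda>y. F (Z m y))"
      by (rule P.integrable_const_bound[where B=k]) (use F_bound in auto)
    ultimately show ?case by simp
  qed
  from Lim_transform_eventually[OF tendsto_add[OF diff lim] this]
  show ?thesis by (simp add: b_def)
qed

text \<open>The limit law is continuous, so the distribution functions converge at \<open>q\<close>;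
  the exceedance event is the complement.\<close>

lemma tendsto_exceedance:
  assumes Q: "\<And>m. prob_space (Q m)" and sets_Q: "\<And>m. sets (Q m) = sets (prod_power M m)"
    and lim: "weak_conv_m (\<lambda>m. distr (Q m) borel (Z m)) (density lborel (normal_density h 1))"
  shows "(\<lambda>m. measure (Q m) {y \<in> space (Q m). Z m y > q}) \<longlonglongrightarrow> 1 - std_normal_cdf (q - h)"
proof -
  have "(\<lambda>m. 1 - cdf (distr (Q m) borel (Z m)) q) \<longlonglongrightarrow>
      1 - cdf (density lborel (normal_density h 1)) q"
    using lim isCont_cdf_normal[where \<mu>=h and \<sigma>=1]
    by (intro tendsto_diff tendsto_const) (auto simp: weak_conv_m_def weak_conv_def)
  moreover have "1 - cdf (distr (Q m) borel (Z m)) q = measure (Q m) {y \<in> space (Q m). Z m y > q}" for m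
  proof -
    interpret Q: prob_space "Q m" by (rule Q)
    have [measurable]: "Z m \<in> borel_measurable (Q m)"
      using Z_measurable measurable_cong_sets[OF sets_Q refl] by blast
    have "cdf (distr (Q m) borel (Z m)) q = Q.prob {y \<in> space (Q m). Z m y \<le> q}"
      by (auto simp: cdf_def measure_distr intro!: arg_cong[where f=Q.prob])
    moreover have "Q.prob (space (Q m) - {y \<in> space (Q m). Z m y \<le> q}) = 1 - Q.prob {y \<in> space (Q m). Z m y \<le> q}"
      by (rule Q.prob_compl) measurable
    moreover have "space (Q m) - {y \<in> space (Q m). Z m y \<le> q} = {y \<in> space (Q m). Z m y > q}"
      by auto
    ultimately show ?thesis by simp
  qed
  ultimately show ?thesis by (simp add: cdf_normal_distribution)
qed

end

subsection \<open>Mixtures as local perturbations\<close>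

text \<open>By linearity the density is \<open>(1 - a) + a r\<close>. Both weights are nonnegative,
  so \<open>ennreal\<close> truncates nothing.\<close>

lemma mixture_eq_density:
  assumes P0: "prob_space P0" and P1: "prob_space P1" and sets_eq: "sets P1 = sets P0"
    and ac: "absolutely_continuous P0 P1"
    and r_meas [measurable]: "r \<in> borel_measurable P0"
    and r: "AE y in P0. r y = enn2real (RN_deriv P0 P1 y)"
    and a: "0 \<le> a" "a \<le> 1"
  shows "mixture a P0 P1 = density P0 (\<lambda>y. ennreal (1 + a * (r y - 1)))"
proof (rule measure_eqI)
  interpret P0: prob_space P0 by (rule P0)
  interpret P1: prob_space P1 by (rule P1)
  have r_nonneg: "AE y in P0. 0 \<le> r y"
    using r by eventually_elim simp
  have P1_density: "P1 = density P0 (\<lambda>y. ennreal (r y))"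
  proof -
    have "P1 = density P0 (RN_deriv P0 P1)"
      by (rule P0.density_RN_deriv[OF ac sets_eq, symmetric])
    also have "\<dots> = density P0 (\<lambda>y. ennreal (r y))"
    proof (rule density_cong)
      \<comment> \<open>\<open>enn2real\<close> loses information only where the derivative is
        infinite, a null set because \<open>P1\<close> is sigma-finite.\<close>
      show "AE y in P0. RN_deriv P0 P1 y = ennreal (r y)"
        using r P0.RN_deriv_finite[OF P1.sigma_finite_measure_axioms ac sets_eq]
        by eventually_elim (simp add: less_top)
    qed measurable
    finally show ?thesis .
  qed
  fix A assume "A \<in> sets (mixture a P0 P1)"
  then have A [measurable]: "A \<in> sets P0" by simp
  have "emeasure P1 A = (\<integral>\<^sup>+y. ennreal (r y) * indicator A y \<partial>P0)"
    by (subst P1_density) (simp add: emeasure_density)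
  then have "emeasure (mixture a P0 P1) A =
      ennreal (1 - a) * (\<integral>\<^sup>+y. indicator A y \<partial>P0) + ennreal a * (\<integral>\<^sup>+y. ennreal (r y) * indicator A y \<partial>P0)"
    by (simp add: emeasure_mixture[OF sets_eq A])
  also have "\<dots> = (\<integral>\<^sup>+y. ennreal (1 - a) * indicator A y + ennreal a * (ennreal (r y) * indicator A y) \<partial>P0)"
    by (simp add: nn_integral_add nn_integral_cmult)
  also have "\<dots> = (\<integral>\<^sup>+y. ennreal (1 + a * (r y - 1)) * indicator A y \<partial>P0)"
  proof (rule nn_integral_cong_AE)
    show "AE y in P0. ennreal (1 - a) * indicator A y + ennreal a * (ennreal (r y) * indicator A y) =
        ennreal (1 + a * (r y - 1)) * indicator A y"
      using r_nonneg
    proof eventually_elim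
      case (elim y)
      have "ennreal (1 - a) + ennreal a * ennreal (r y) = ennreal (1 + a * (r y - 1))"
        using a elim by (simp add: ennreal_mult[symmetric] ennreal_plus[symmetric] algebra_simps
          del: ennreal_plus)
      then show ?case by (simp add: indicator_def)
    qed
  qed
  finally show "emeasure (mixture a P0 P1) A =
      emeasure (density P0 (\<lambda>y. ennreal (1 + a * (r y - 1)))) A"
    by (simp add: emeasure_density)
qed simp

text \<open>Total mass 1 of \<open>P1\<close> forces \<open>r\<close> to have mean 1, so
  \<open>g\<close> has mean zero; nonnegativity of \<open>r\<close> gives the lower bound on
  \<open>g\<close>.\<close>

lemma score_RN_deriv:
  assumes P0: "prob_space P0" and P1: "prob_space P1" and sets_eq: "sets P1 = sets P0"
    and ac: "absolutely_continuous P0 P1"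
    and r_meas [measurable]: "r \<in> borel_measurable P0"
    and r: "AE y in P0. r y = enn2real (RN_deriv P0 P1 y)"
    and g: "g = (\<lambda>y. r y - 1)"
    and g_sq: "integrable P0 (\<lambda>y. (g y)\<^sup>2)"
    and \<rho>: "\<rho> = sqrt (\<integral>y. (g y)\<^sup>2 \<partial>P0)" and \<rho>_pos: "\<rho> > 0"
  shows "score P0 g \<rho>"
proof -
  interpret P0: prob_space P0 by (rule P0)
  interpret P1: prob_space P1 by (rule P1)
  have g_meas [measurable]: "g \<in> borel_measurable P0" by (simp add: g)
  have r_nonneg: "AE y in P0. 0 \<le> r y"
    using r by eventually_elim simp
  have g_int: "integrable P0 g"
    by (rule P0.square_integrable_imp_integrable[OF g_meas g_sq])
  have "P0.expectation r = 1"
  proof -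
    \<comment> \<open>The mixture with weight 1 is a probability measure with density
      \<open>r\<close>, whose integral is therefore 1.\<close>
    have "mixture 1 P0 P1 = density P0 (\<lambda>y. ennreal (r y))"
      using mixture_eq_density[OF P0 P1 sets_eq ac r_meas r, of 1] by simp
    then have "emeasure (density P0 (\<lambda>y. ennreal (r y))) (space P0) = 1"
      using prob_space.emeasure_space_1[OF prob_space_mixture[OF P0 P1 sets_eq, of 1]] by simp
    then have "(\<integral>\<^sup>+y. ennreal (r y) \<partial>P0) = 1"
      by (simp add: emeasure_density cong: nn_integral_cong)
    then show ?thesis
      by (subst integral_eq_nn_integral) (use r_nonneg in auto)
  qed
  moreover have "r = (\<lambda>y. g y + 1)" by (simp add: g)
  ultimately have mean: "P0.expectation g = 0"
    using g_int by (simp add: P0.prob_space)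
  have "P0.expectation (\<lambda>y. (g y)\<^sup>2) = \<rho>\<^sup>2"
    by (simp add: \<rho>)
  then show ?thesis
    using g_meas g_sq mean \<rho>_pos r_nonneg
    by unfold_locales (auto simp: g)
qed

theorem theorem7:
  fixes P0 P1 :: "'a measure" and r g :: "'a \<Rightarrow> real" and \<rho> \<epsilon> h \<tau> :: real
    and Z :: "nat \<Rightarrow> (nat \<Rightarrow> 'a) \<Rightarrow> real" and \<alpha> :: "nat \<Rightarrow> real"
  assumes P0: "prob_space P0" and P1: "prob_space P1" and sets_eq: "sets P1 = sets P0"
    and ac: "absolutely_continuous P0 P1"
    and r_meas: "r \<in> borel_measurable P0"
    and r: "AE y in P0. r y = enn2real (RN_deriv P0 P1 y)"
    and g: "g = (\<lambda>y. r y - 1)"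
    and g_sq: "integrable P0 (\<lambda>y. (g y)\<^sup>2)"
    and \<rho>: "\<rho> = sqrt (\<integral>y. (g y)\<^sup>2 \<partial>P0)"
    and \<rho>_pos: "\<rho> > 0"
    and \<epsilon>: "\<epsilon> > 0"
    and g_mom: "integrable P0 (\<lambda>y. \<bar>g y\<bar> powr (2 + \<epsilon>))"
    and Z: "Z = (\<lambda>m y. (1 / (\<rho> * sqrt (real m))) * (\<Sum>i<m. g (y i)))"
    and h: "h \<ge> 0"
    and \<tau>: "0 < \<tau>" "\<tau> < 1"
    and \<alpha>: "\<forall>\<^sub>F m in sequentially. \<alpha> m = h / (\<rho> * sqrt (real m))"
  shows
    "vanishes_in_prob (prod_power P0)
       (\<lambda>m y. ln (enn2real (RN_deriv (prod_power P0 m) (prod_power (mixture (\<alpha> m) P0 P1) m) y))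
              - (h * Z m y - h\<^sup>2 / 2))
     \<and>
     (weak_conv_m (\<lambda>m. distr (prod_power P0 m) borel (Z m)) (density lborel (normal_density 0 1)) \<and>
      weak_conv_m (\<lambda>m. distr (prod_power (mixture (\<alpha> m) P0 P1) m) borel (Z m))
        (density lborel (normal_density h 1)))
     \<and>
     ((\<lambda>m. measure (prod_power P0 m)
             {y \<in> space (prod_power P0 m). Z m y > std_normal_quantile (1 - \<tau>)})
        \<longlonglongrightarrow> \<tau> \<and>
      (\<lambda>m. measure (prod_power (mixture (\<alpha> m) P0 P1) m)
             {y \<in> space (prod_power (mixture (\<alpha> m) P0 P1) m). Z m y > std_normal_quantile (1 - \<tau>)})
        \<longlonglongrightarrow> 1 - std_normal_cdf (std_normal_quantile (1 - \<tau>) - h))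
     \<and>
     (\<forall>\<psi> :: nat \<Rightarrow> (nat \<Rightarrow> 'a) \<Rightarrow> real.
        (\<forall>m. \<psi> m \<in> borel_measurable (prod_power P0 m)) \<longrightarrow>
        (\<forall>m. \<forall>y\<in>space (prod_power P0 m). 0 \<le> \<psi> m y \<and> \<psi> m y \<le> 1) \<longrightarrow>
        limsup (\<lambda>m. ereal (\<integral>y. \<psi> m y \<partial>prod_power P0 m)) \<le> ereal \<tau> \<longrightarrow>
        limsup (\<lambda>m. ereal (\<integral>y. \<psi> m y \<partial>prod_power (mixture (\<alpha> m) P0 P1) m))
          \<le> ereal (1 - std_normal_cdf (std_normal_quantile (1 - \<tau>) - h)))"
proof -
  interpret score P0 g \<rho>
    by (rule score_RN_deriv[OF P0 P1 sets_eq ac r_meas r g g_sq \<rho> \<rho>_pos])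
  have Z: "Z = score.Z g \<rho>"
    by (auto simp: Z Z_def fun_eq_iff)
  define Q where "Q m = prod_power (mixture (\<alpha> m) P0 P1) m" for m
  define b where "b m = h / (\<rho> * sqrt (real m))" for m
  \<comment> \<open>For small \<open>m\<close>, \<open>\<alpha> m\<close> is arbitrary and
    \<open>b m\<close> may exceed 1. The sequence \<open>c\<close> stays in [0, 1/2] for every
    \<open>m\<close> and agrees with both eventually.\<close>
  define c where "c m = (if b m \<le> 1 / 2 then b m else 0)" for m
  have b_nonneg: "0 \<le> b m" for m using h \<rho>_pos by (simp add: b_def)
  have c: "0 \<le> c m" "c m < 1" "c m \<le> 1" for m using b_nonneg by (auto simp: c_def)
  have c_eq: "\<forall>\<^sub>F m in sequentially. c m = b m"
    using eventually_scale_less_half[of h] by eventually_elim (simp add: c_def b_def)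
  have mixture_eq: "mixture (c m) P0 P1 = tilted (c m)" for m
    unfolding tilted_def using mixture_eq_density[OF P0 P1 sets_eq ac r_meas r c(1,3)] by (simp add: g)
  have Q_eq: "\<forall>\<^sub>F m in sequentially. Q m = prod_power (tilted (c m)) m"
    using \<alpha> c_eq
  proof eventually_elim
    case (elim m)
    then have "\<alpha> m = c m" by (simp add: b_def)
    then show ?case by (simp add: Q_def mixture_eq)
  qed
  have Q_sets: "sets (Q m) = sets (prod_power P0 m)" "space (Q m) = space (prod_power P0 m)" for m
    unfolding Q_def prod_power_def by (auto intro!: sets_PiM_cong simp: space_PiM)

  have i: "vanishes_in_prob (prod_power P0)
     (\<lambda>m y. ln (enn2real (RN_deriv (prod_power P0 m) (Q m) y)) - (h * Z m y - h\<^sup>2 / 2))"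
  proof (rule vanishes_in_prob_cong_AE[OF _ log_likelihood_expansion[OF h]])
    \<comment> \<open>Measurability is demanded for every \<open>m\<close>, also where
      \<open>\<alpha> m\<close> is unconstrained; \<open>RN_deriv\<close> is measurable in all
      cases.\<close>
    show "(\<lambda>y. ln (enn2real (RN_deriv (prod_power P0 m) (Q m) y)) - (h * Z m y - h\<^sup>2 / 2))
        \<in> borel_measurable (prod_power P0 m)" for m
      unfolding Z using Z_measurable[of m] by measurable
    show "\<forall>\<^sub>F m in sequentially. AE y in prod_power P0 m.
        ln (\<Prod>i<m. 1 + h / (\<rho> * sqrt m) * g (y i)) - (h * score.Z g \<rho> m y - h\<^sup>2 / 2) =
        ln (enn2real (RN_deriv (prod_power P0 m) (Q m) y)) - (h * Z m y - h\<^sup>2 / 2)"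
      using Q_eq c_eq
    proof eventually_elim
      case (elim m)
      show ?case
        using RN_deriv_tilted[OF c(1,2), of m m]
        by eventually_elim (simp add: elim Z lik_def b_def)
    qed
  qed

  have tilted_limit: "weak_conv_m (\<lambda>m. distr (prod_power (tilted (c m)) m) borel (Z m))
      (density lborel (normal_density h 1))"
    unfolding Z using c_eq by (intro weak_conv_tilted[OF h c(1,3)]) (simp add: b_def)
  have ii: "weak_conv_m (\<lambda>m. distr (prod_power P0 m) borel (Z m)) std_normal_distribution"
    unfolding Z by (rule weak_conv_null)
  have ii': "weak_conv_m (\<lambda>m. distr (Q m) borel (Z m)) (density lborel (normal_density h 1))"
    unfolding weak_conv_m_def weak_conv_def
  proof (intro allI impI)
    fix x assume "isCont (cdf (density lborel (normal_density h 1))) x"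
    then have "(\<lambda>m. cdf (distr (prod_power (tilted (c m)) m) borel (Z m)) x)
        \<longlonglongrightarrow> cdf (density lborel (normal_density h 1)) x"
      using tilted_limit by (simp add: weak_conv_m_def weak_conv_def)
    then show "(\<lambda>m. cdf (distr (Q m) borel (Z m)) x) \<longlonglongrightarrow> cdf (density lborel (normal_density h 1)) x"
      by (rule Lim_transform_eventually) (use Q_eq in \<open>eventually_elim, simp\<close>)
  qed

  let ?q = "std_normal_quantile (1 - \<tau>)"
  have quantile: "std_normal_cdf ?q = 1 - \<tau>"
    using \<tau> by (intro std_normal_cdf_quantile) auto
  have iii: "(\<lambda>m. measure (prod_power P0 m) {y \<in> space (prod_power P0 m). Z m y > ?q}) \<longlonglongrightarrow> \<tau>"
    using tendsto_exceedance[OF prob_space_prod_power refl, of 0 ?q] ii quantile by (simp add: Z)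
  have "(\<lambda>m. measure (prod_power (tilted (c m)) m) {y \<in> space (prod_power (tilted (c m)) m). Z m y > ?q})
      \<longlonglongrightarrow> 1 - std_normal_cdf (?q - h)"
    unfolding Z using tilted_limit prob_space_tilted[OF c(1,3)]
    by (intro tendsto_exceedance prob_space.prob_space_prod_power) (auto simp: Z)
  then have iii': "(\<lambda>m. measure (Q m) {y \<in> space (Q m). Z m y > ?q}) \<longlonglongrightarrow> 1 - std_normal_cdf (?q - h)"
    by (rule Lim_transform_eventually) (use Q_eq in \<open>eventually_elim, simp\<close>)

  have iv: "limsup (\<lambda>m. ereal (\<integral>y. \<psi> m y \<partial>Q m)) \<le> ereal (1 - std_normal_cdf (?q - h))"
    if \<psi>: "\<And>m. \<psi> m \<in> borel_measurable (prod_power P0 m)"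
      "\<And>m y. y \<in> space (prod_power P0 m) \<Longrightarrow> 0 \<le> \<psi> m y \<and> \<psi> m y \<le> 1"
      and level: "limsup (\<lambda>m. ereal (\<integral>y. \<psi> m y \<partial>prod_power P0 m)) \<le> ereal \<tau>"
    for \<psi> :: "nat \<Rightarrow> (nat \<Rightarrow> 'a) \<Rightarrow> real"
  proof -
    \<comment> \<open>The density of \<open>N(h, 1)\<close> relative to \<open>N(0, 1)\<close> at
      the threshold \<open>?q\<close>: the critical value of the likelihood ratio in the limiting
      Gaussian problem.\<close>
    define k where "k = exp (h * ?q - h\<^sup>2 / 2)"
    have k: "0 < k" by (simp add: k_def)
    let ?d = "\<lambda>m. 1 - k + (\<integral>y. max 0 (k - lik (b m) m y) \<partial>prod_power P0 m)"
    have "\<forall>\<^sub>F m in sequentially. (\<integral>y. \<psi> m y \<partial>Q m) \<le> k * (\<integral>y. \<psi> m y \<partial>prod_power P0 m) + ?d m"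
      using Q_eq c_eq
    proof eventually_elim
      case (elim m)
      show ?case
        using Neyman_Pearson_bound[OF c(1,2) less_imp_le[OF k] \<psi>, of m m] elim by simp
    qed
    moreover have "?d \<longlonglongrightarrow> 1 - k + (k * std_normal_cdf ?q - std_normal_cdf (?q - h))"
      unfolding k_def b_def by (intro tendsto_add tendsto_const tendsto_integral_pos_part_lik h)
    ultimately have "limsup (\<lambda>m. ereal (\<integral>y. \<psi> m y \<partial>Q m)) \<le>
        ereal (k * \<tau> + (1 - k + (k * std_normal_cdf ?q - std_normal_cdf (?q - h))))"
      using k level by (intro limsup_affine_le)
    \<comment> \<open>Since \<open>std_normal_cdf ?q = 1 - \<tau>\<close>, all terms containing
      \<open>k\<close> cancel.\<close>
    also have "k * \<tau> + (1 - k + (k * std_normal_cdf ?q - std_normal_cdf (?q - h))) =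
        1 - std_normal_cdf (?q - h)"
      by (simp add: quantile algebra_simps)
    finally show ?thesis .
  qed

  show ?thesis
    using i ii ii' iii iii' iv unfolding Q_def by blast
qed

end
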